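(* Let $\Gamma$ be the defining graph of an Artin group $A_\Gamma$, and suppose that $\Gamma$ has exactly one cone point $t$. Then $A_\Gamma$ satisfies the Center Conjecture; that is, $Z(A_\Gamma)=\{1\}$ if and only if there exists $s\in V(\Gamma)\setminus\{t\}$ such that $m_{st}\neq 2$.
   Context: $Z(G)$ denotes the center of a group $G$. A defining graph is a finite simplicial graph $\Gamma$ with vertex set $V(\Gamma)=\{s_1,\dots,s_n\}$ in which each edge $(s_i,s_j)$ carries an integer label $m_{ij}=m_{ji}\ge 2$ (for $s,t\in V(\Gamma)$ the label of the edge $(s,t)$ is also written $m_{st}$); if two distinct vertices are not joined by an edge, the corresponding $m$ is $\infty$. The Artin group $A_\Gamma$ is the group with generators $V(\Gamma)$ and, for each edge $(s_i,s_j)$, the relation $s_is_js_i\cdots=s_js_is_j\cdots$ with $m_{ij}$ letters on each side (no relation is imposed when $m_{ij}=\infty$). The Coxeter group $W_\Gamma$ is the quotient of $A_\Gamma$ by the relations $s_i^2=1$ for all $i$. $A_\Gamma$ is spherical if $W_\Gamma$ is finite. A 2-labelled join $\Gamma_1*_2\Gamma_2$ is the graph join of labelled graphs $\Gamma_1,\Gamma_2$ in which every edge between a vertex of $\Gamma_1$ and a vertex of $\Gamma_2$ has label $2$, and the edges within each factor keep their labels. A (nonempty) defining graph $\Gamma$, and the group $A_\Gamma$, are irreducible if $\Gamma$ does not split as a 2-labelled join of two nonempty graphs. Every $\Gamma$ has a maximal decomposition $\Gamma=\Gamma_1*_2\cdots*_2\Gamma_n$ with each $\Gamma_i$ irreducible,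 giving the decomposition into irreducible factors $A_\Gamma=A_{\Gamma_1}\times\cdots\times A_{\Gamma_n}$. The Artin group $A_\Gamma$ satisfies the Center Conjecture if $Z(A_\Gamma)\cong\mathbb{Z}^k$, where $k$ is the number of irreducible factors $A_{\Gamma_i}$ of $A_\Gamma$ that are spherical. A cone point of $\Gamma$ is a vertex that is adjacent to every other vertex of $\Gamma$ (the edge labels being arbitrary). *)

theory Defs
  imports "HOL-Algebra.Product_Groups" "HOL-Library.Extended_Nat"
begin

section \<open>Groups given by generators and relations\<close>

text \<open>A letter \<open>(x, True)\<close> stands for the generator \<open>x\<close> and \<open>(x, False)\<close> for its inverse.\<close>

type_synonym 'a word = "('a \<times> bool) list"

definition words :: "'a set \<Rightarrow> 'a word set" where
  "words X = lists (X \<times> UNIV)"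

text \<open>A relation \<open>l = r\<close> is the pair \<open>(l, r)\<close>. Two words are equivalent if they represent the
  same element of the group generated by \<open>X\<close> subject to \<open>R\<close>.\<close>

inductive word_equiv :: "'a set \<Rightarrow> ('a word \<times> 'a word) set \<Rightarrow> 'a word \<Rightarrow> 'a word \<Rightarrow> bool"
  for X R where
  cancel: "\<lbrakk>u \<in> words X; v \<in> words X; x \<in> X\<rbrakk>
    \<Longrightarrow> word_equiv X R (u @ [(x, b), (x, \<not> b)] @ v) (u @ v)"
| relation: "\<lbrakk>u \<in> words X; v \<in> words X; l \<in> words X; r \<in> words X; (l, r) \<in> R\<rbrakk>
    \<Longrightarrow> word_equiv X R (u @ l @ v) (u @ r @ v)"
| refl: "w \<in> words X \<Longrightarrow> word_equiv X R w w"
| sym: "word_equiv X R w w' \<Longrightarrow> word_equiv X R w' w"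
| trans: "\<lbrakk>word_equiv X R w w'; word_equiv X R w' w''\<rbrakk> \<Longrightarrow> word_equiv X R w w''"

definition word_rel :: "'a set \<Rightarrow> ('a word \<times> 'a word) set \<Rightarrow> ('a word \<times> 'a word) set" where
  "word_rel X R = {(u, v). word_equiv X R u v}"

definition presented_group :: "'a set \<Rightarrow> ('a word \<times> 'a word) set \<Rightarrow> 'a word set monoid" where
  "presented_group X R =
    \<lparr>carrier = words X // word_rel X R,
     monoid.mult = (\<lambda>A B. \<Union>u\<in>A. \<Union>v\<in>B. word_rel X R `` {u @ v}),
     one = word_rel X R `` {[]}\<rparr>"

lemma words_Nil [simp]: "[] \<in> words X"
  and words_Cons [simp]: "a # w \<in> words X \<longleftrightarrow> fst a \<in> X \<and> w \<in> words X"
  and words_append [simp]: "u @ v \<in> words X \<longleftrightarrow> u \<in> words X \<and> v \<in> words X"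
  by (auto simp: words_def mem_Times_iff)

lemma word_equiv_words: "word_equiv X R u v \<Longrightarrow> u \<in> words X \<and> v \<in> words X"
  by (induction rule: word_equiv.induct) auto

lemma equiv_word_rel: "equiv (words X) (word_rel X R)"
proof (rule equivI)
  show "word_rel X R \<subseteq> words X \<times> words X"
    using word_equiv_words unfolding word_rel_def by fastforce
  show "refl_on (words X) (word_rel X R)"
    by (auto simp: refl_on_def word_rel_def intro: word_equiv.refl)
  show "Relation.sym (word_rel X R)"
    by (auto simp: sym_def word_rel_def intro: word_equiv.sym)
  show "Relation.trans (word_rel X R)"
    by (auto simp: trans_def word_rel_def intro: word_equiv.trans)
qed

lemma word_equiv_append:
  assumes "word_equiv X R u v" "a \<in> words X" "b \<in> words X"
  shows "word_equiv X R (a @ u @ b) (a @ v @ b)"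
  using assms(1)
proof (induction rule: word_equiv.induct)
  case (cancel u v x c)
  then show ?case
    using word_equiv.cancel[of "a @ u" X "v @ b" x R c] assms by simp
next
  case (relation u v l r)
  then show ?case
    using word_equiv.relation[of "a @ u" X "v @ b" l r R] assms by simp
next
  case (refl w)
  then show ?case using assms by (simp add: word_equiv.refl)
qed (blast intro: word_equiv.sym word_equiv.trans)+

lemma word_equiv_append2:
  assumes "word_equiv X R u u'" "word_equiv X R v v'"
  shows "word_equiv X R (u @ v) (u' @ v')"
proof -
  have "word_equiv X R (u @ v) (u' @ v)"
    using word_equiv_append[OF assms(1), of "[]" v] word_equiv_words[OF assms(2)] by simp
  moreover have "word_equiv X R (u' @ v) (u' @ v')"
    using word_equiv_append[OF assms(2), of u' "[]"] word_equiv_words[OF assms(1)] by simp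
  ultimately show ?thesis by (rule word_equiv.trans)
qed

lemma presented_group_mult:
  assumes "u \<in> words X" "v \<in> words X"
  shows "(word_rel X R `` {u}) \<otimes>\<^bsub>presented_group X R\<^esub> (word_rel X R `` {v})
    = word_rel X R `` {u @ v}"
proof -
  let ?r = "word_rel X R"
  have eq: "?r `` {u' @ v'} = ?r `` {u @ v}" if "u' \<in> ?r `` {u}" "v' \<in> ?r `` {v}" for u' v'
  proof -
    have "(u @ v, u' @ v') \<in> ?r"
      using that word_equiv_append2 by (auto simp: word_rel_def)
    then show ?thesis using equiv_class_eq[OF equiv_word_rel] by metis
  qed
  have ne: "u \<in> ?r `` {u}" "v \<in> ?r `` {v}"
    using assms by (auto simp: word_rel_def intro: word_equiv.refl)
  have "(\<Union>u'\<in>?r `` {u}. \<Union>v'\<in>?r `` {v}. ?r `` {u' @ v'})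
      = (\<Union>u'\<in>?r `` {u}. \<Union>v'\<in>?r `` {v}. ?r `` {u @ v})"
    by (intro SUP_cong HOL.refl eq)
  also have "\<dots> = ?r `` {u @ v}" using ne by blast
  finally show ?thesis by (simp add: presented_group_def)
qed

definition inv_word :: "'a word \<Rightarrow> 'a word" where
  "inv_word w = rev (map (\<lambda>(x, b). (x, \<not> b)) w)"

lemma inv_word_words: "w \<in> words X \<Longrightarrow> inv_word w \<in> words X"
  by (induction w) (auto simp: inv_word_def)

lemma inv_word_cancel: "w \<in> words X \<Longrightarrow> word_equiv X R (inv_word w @ w) []"
proof (induction w)
  case Nil
  then show ?case by (simp add: inv_word_def word_equiv.refl)
next
  case (Cons a w)
  obtain x b where a: "a = (x, b)" by (cases a)
  have "word_equiv X R (inv_word w @ [(x, \<not> b), (x, \<not> \<not> b)] @ w) (inv_word w @ w)"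
    using Cons.prems a by (intro word_equiv.cancel) (auto intro: inv_word_words)
  moreover have "inv_word (a # w) @ a # w = inv_word w @ [(x, \<not> b), (x, \<not> \<not> b)] @ w"
    by (simp add: inv_word_def a)
  ultimately show ?case using Cons by (auto intro: word_equiv.trans)
qed

lemma group_presented_group: "group (presented_group X R)"
proof (rule groupI)
  let ?G = "presented_group X R" and ?r = "word_rel X R"
  have car: "A \<in> carrier ?G \<longleftrightarrow> (\<exists>u\<in>words X. A = ?r `` {u})" for A
    by (auto simp: presented_group_def quotient_def)
  have one: "\<one>\<^bsub>?G\<^esub> = ?r `` {[]}" by (simp add: presented_group_def)
  show "A \<otimes>\<^bsub>?G\<^esub> B \<in> carrier ?G" if "A \<in> carrier ?G" "B \<in> carrier ?G" for A B
    using that presented_group_mult unfolding car by (metis words_append)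
  show "\<one>\<^bsub>?G\<^esub> \<in> carrier ?G" unfolding car one by auto
  show "A \<otimes>\<^bsub>?G\<^esub> B \<otimes>\<^bsub>?G\<^esub> C = A \<otimes>\<^bsub>?G\<^esub> (B \<otimes>\<^bsub>?G\<^esub> C)"
    if "A \<in> carrier ?G" "B \<in> carrier ?G" "C \<in> carrier ?G" for A B C
    using that unfolding car by (auto simp: presented_group_mult)
  show "\<one>\<^bsub>?G\<^esub> \<otimes>\<^bsub>?G\<^esub> A = A" if "A \<in> carrier ?G" for A
    using that unfolding car one by (auto simp: presented_group_mult)
  show "\<exists>B\<in>carrier ?G. B \<otimes>\<^bsub>?G\<^esub> A = \<one>\<^bsub>?G\<^esub>" if A: "A \<in> carrier ?G" for A
  proof -
    obtain u where u: "u \<in> words X" "A = ?r `` {u}" using A unfolding car by blast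
    have "?r `` {inv_word u @ u} = ?r `` {[]}"
      using equiv_class_eq[OF equiv_word_rel] inv_word_cancel[OF u(1)]
      by (fastforce simp: word_rel_def)
    then have "?r `` {inv_word u} \<otimes>\<^bsub>?G\<^esub> A = \<one>\<^bsub>?G\<^esub>"
      by (simp add: u(2) one presented_group_mult[OF inv_word_words[OF u(1)] u(1)])
    moreover have "?r `` {inv_word u} \<in> carrier ?G"
      unfolding car using inv_word_words[OF u(1)] by blast
    ultimately show ?thesis by blast
  qed
qed

definition center :: "('a, 'b) monoid_scheme \<Rightarrow> 'a set" where
  "center G = {z \<in> carrier G. \<forall>g\<in>carrier G. z \<otimes>\<^bsub>G\<^esub> g = g \<otimes>\<^bsub>G\<^esub> z}"


section \<open>Defining graphs\<close>

text \<open>The edges are the two-element vertex sets in the domain of the partial function \<open>label\<close>.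
  With the edge set encoded as a domain, equality of records is equality of labelled graphs.\<close>

record 'a lgraph =
  verts :: "'a set"
  label :: "'a set \<rightharpoonup> nat"

definition defining_graph :: "'a lgraph \<Rightarrow> bool" where
  "defining_graph \<Gamma> \<longleftrightarrow> finite (verts \<Gamma>)
    \<and> (\<forall>e\<in>dom (label \<Gamma>). e \<subseteq> verts \<Gamma> \<and> card e = 2)
    \<and> (\<forall>e k. label \<Gamma> e = Some k \<longrightarrow> 2 \<le> k)"

definition adjacent :: "'a lgraph \<Rightarrow> 'a \<Rightarrow> 'a \<Rightarrow> bool" where
  "adjacent \<Gamma> s t \<longleftrightarrow> {s, t} \<in> dom (label \<Gamma>)"

text \<open>Meaningful only for distinct vertices \<open>s\<close> and \<open>t\<close>.\<close>

definition m_label :: "'a lgraph \<Rightarrow> 'a \<Rightarrow> 'a \<Rightarrow> enat" where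
  "m_label \<Gamma> s t = (case label \<Gamma> {s, t} of Some k \<Rightarrow> enat k | None \<Rightarrow> \<infinity>)"

definition cone_point :: "'a lgraph \<Rightarrow> 'a \<Rightarrow> bool" where
  "cone_point \<Gamma> t \<longleftrightarrow> t \<in> verts \<Gamma> \<and> (\<forall>s\<in>verts \<Gamma> - {t}. adjacent \<Gamma> s t)"


section \<open>Artin and Coxeter groups\<close>

text \<open>The word \<open>s t s \<dots>\<close> with the given number of letters.\<close>

fun alt_word :: "nat \<Rightarrow> 'a \<Rightarrow> 'a \<Rightarrow> 'a word" where
  "alt_word 0 s t = []"
| "alt_word (Suc k) s t = (s, True) # alt_word k t s"

definition artin_relations :: "'a lgraph \<Rightarrow> ('a word \<times> 'a word) set" where
  "artin_relations \<Gamma> = {(alt_word k s t, alt_word k t s) | k s t. label \<Gamma> {s, t} = Some k}"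

definition artin_group :: "'a lgraph \<Rightarrow> 'a word set monoid" where
  "artin_group \<Gamma> = presented_group (verts \<Gamma>) (artin_relations \<Gamma>)"

definition coxeter_group :: "'a lgraph \<Rightarrow> 'a word set monoid" where
  "coxeter_group \<Gamma> = presented_group (verts \<Gamma>)
    (artin_relations \<Gamma> \<union> {([(s, True), (s, True)], []) | s. s \<in> verts \<Gamma>})"

definition spherical :: "'a lgraph \<Rightarrow> bool" where
  "spherical \<Gamma> \<longleftrightarrow> finite (carrier (coxeter_group \<Gamma>))"


section \<open>Joins and irreducible factors\<close>

text \<open>Used only for graphs with disjoint vertex sets.\<close>

definition join2 :: "'a lgraph \<Rightarrow> 'a lgraph \<Rightarrow> 'a lgraph" where
  "join2 \<Gamma>\<^sub>1 \<Gamma>\<^sub>2 =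
    \<lparr>verts = verts \<Gamma>\<^sub>1 \<union> verts \<Gamma>\<^sub>2,
     label = (\<lambda>e. if e \<subseteq> verts \<Gamma>\<^sub>1 then label \<Gamma>\<^sub>1 e
                  else if e \<subseteq> verts \<Gamma>\<^sub>2 then label \<Gamma>\<^sub>2 e
                  else if \<exists>a\<in>verts \<Gamma>\<^sub>1. \<exists>b\<in>verts \<Gamma>\<^sub>2. e = {a, b} then Some 2
                  else None)\<rparr>"

definition empty_graph :: "'a lgraph" where
  "empty_graph = \<lparr>verts = {}, label = Map.empty\<rparr>"

definition irreducible_graph :: "'a lgraph \<Rightarrow> bool" where
  "irreducible_graph \<Gamma> \<longleftrightarrow> defining_graph \<Gamma> \<and> verts \<Gamma> \<noteq> {} \<and>
    \<not> (\<exists>\<Gamma>\<^sub>1 \<Gamma>\<^sub>2. defining_graph \<Gamma>\<^sub>1 \<and> defining_graph \<Gamma>\<^sub>2 \<and> verts \<Gamma>\<^sub>1 \<noteq> {} \<and> verts \<Gamma>\<^sub>2 \<noteq> {} \<and>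
         verts \<Gamma>\<^sub>1 \<inter> verts \<Gamma>\<^sub>2 = {} \<and> \<Gamma> = join2 \<Gamma>\<^sub>1 \<Gamma>\<^sub>2)"

definition irreducible_decomposition :: "'a lgraph \<Rightarrow> 'a lgraph list \<Rightarrow> bool" where
  "irreducible_decomposition \<Gamma> Ds \<longleftrightarrow> (\<forall>D\<in>set Ds. irreducible_graph D)
    \<and> sorted_wrt (\<lambda>D D'. verts D \<inter> verts D' = {}) Ds
    \<and> \<Gamma> = foldr join2 Ds empty_graph"

text \<open>The decomposition exists and is unique up to the order of the factors, see
  \<open>irreducible_factors_eq\<close> and \<open>irreducible_decomposition_exists\<close> below. Its factors are
  nonempty and disjoint, so no factor is repeated in the list.\<close>

definition irreducible_factors :: "'a lgraph \<Rightarrow> 'a lgraph set" where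
  "irreducible_factors \<Gamma> = (THE F. \<exists>Ds. irreducible_decomposition \<Gamma> Ds \<and> F = set Ds)"

definition induced :: "'a lgraph \<Rightarrow> 'a set \<Rightarrow> 'a lgraph" where
  "induced \<Gamma> S = \<lparr>verts = S, label = (\<lambda>e. if e \<subseteq> S then label \<Gamma> e else None)\<rparr>"

lemma defining_graph_labelD:
  "defining_graph \<Gamma> \<Longrightarrow> label \<Gamma> e = Some k \<Longrightarrow> e \<subseteq> verts \<Gamma> \<and> card e = 2 \<and> finite e \<and> 2 \<le> k"
  unfolding defining_graph_def by (metis card.infinite domI zero_neq_numeral)

lemma defining_graph_induced:
  "defining_graph \<Gamma> \<Longrightarrow> S \<subseteq> verts \<Gamma> \<Longrightarrow> defining_graph (induced \<Gamma> S)"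
  unfolding defining_graph_def induced_def
  by (auto simp: dom_def intro: finite_subset split: if_splits)

lemma verts_join2 [simp]: "verts (join2 A B) = verts A \<union> verts B"
  by (simp add: join2_def)

lemma defining_graph_empty: "defining_graph empty_graph"
  by (simp add: defining_graph_def empty_graph_def)

lemma verts_empty_graph [simp]: "verts empty_graph = {}"
  by (simp add: empty_graph_def)

lemma verts_induced [simp]: "verts (induced \<Gamma> S) = S"
  by (simp add: induced_def)

lemma defining_graph_verts_empty:
  assumes "defining_graph \<Gamma>" "verts \<Gamma> = {}"
  shows "\<Gamma> = empty_graph"
proof -
  have "label \<Gamma> e = None" for e
    using assms defining_graph_labelD[of \<Gamma> e] by (cases "label \<Gamma> e") auto
  then show ?thesis using assms by (cases \<Gamma>) (auto simp: empty_graph_def)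
qed

text \<open>For disjoint factors, being a 2-labelled join is a condition on the joined graph.\<close>

lemma join2_iff:
  assumes "defining_graph A" "defining_graph B" "verts A \<inter> verts B = {}"
  shows "\<Gamma> = join2 A B \<longleftrightarrow> defining_graph \<Gamma> \<and> verts \<Gamma> = verts A \<union> verts B
    \<and> A = induced \<Gamma> (verts A) \<and> B = induced \<Gamma> (verts B)
    \<and> (\<forall>a\<in>verts A. \<forall>b\<in>verts B. label \<Gamma> {a, b} = Some 2)" (is "?l \<longleftrightarrow> ?r")
proof
  have none: "label A e = None" if "\<not> e \<subseteq> verts A" for e
    using that defining_graph_labelD[OF assms(1), of e] by (cases "label A e") auto
  have none': "label B e = None" if "\<not> e \<subseteq> verts B" for e
    using that defining_graph_labelD[OF assms(2), of e] by (cases "label B e") auto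
  have emp: "label A {} = None" "label B {} = None"
    using defining_graph_labelD[OF assms(1), of "{}"] defining_graph_labelD[OF assms(2), of "{}"]
    by (cases "label A {}"; cases "label B {}"; auto)+
  {
    assume l: ?l
    have lab: "label \<Gamma> e = (if e \<subseteq> verts A then label A e
                  else if e \<subseteq> verts B then label B e
                  else if \<exists>a\<in>verts A. \<exists>b\<in>verts B. e = {a, b} then Some 2
                  else None)" for e
      using l by (simp add: join2_def)
    have ab: "a \<noteq> b" if "a \<in> verts A" "b \<in> verts B" for a b using that assms(3) by auto
    have "e \<subseteq> verts \<Gamma> \<and> card e = 2 \<and> 2 \<le> k" if "label \<Gamma> e = Some k" for e k
      using that defining_graph_labelD[OF assms(1), of e k] defining_graph_labelD[OF assms(2), of e k]
        l ab unfolding lab by (auto split: if_splits)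
    then have d: "defining_graph \<Gamma>"
      using assms(1,2) l unfolding defining_graph_def by auto
    have "label A = label (induced \<Gamma> (verts A))"
      by (auto simp: induced_def lab none)
    then have a: "A = induced \<Gamma> (verts A)" by (cases A) (auto simp: induced_def)
    have "label B e = label (induced \<Gamma> (verts B)) e" for e
    proof (cases "e \<subseteq> verts A \<and> e \<subseteq> verts B")
      case True
      then have "e = {}" using assms(3) by auto
      then show ?thesis by (simp add: induced_def lab emp)
    qed (auto simp: induced_def lab none')
    then have b: "B = induced \<Gamma> (verts B)" by (cases B) (auto simp: induced_def)
    have "label \<Gamma> {a, b} = Some 2" if "a \<in> verts A" "b \<in> verts B" for a b
      using that assms(3) unfolding lab by auto
    with d a b l show ?r by simp
  }
  assume r: ?r
  have "label \<Gamma> e = label (join2 A B) e" for e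
  proof (cases "e \<subseteq> verts A \<or> e \<subseteq> verts B")
    case True
    have "label A e = label (induced \<Gamma> (verts A)) e" "label B e = label (induced \<Gamma> (verts B)) e"
      using r by metis+
    then have "label A e = (if e \<subseteq> verts A then label \<Gamma> e else None)"
      "label B e = (if e \<subseteq> verts B then label \<Gamma> e else None)"
      by (simp_all add: induced_def)
    with True show ?thesis by (auto simp: join2_def)
  next
    case False
    show ?thesis
    proof (cases "\<exists>a\<in>verts A. \<exists>b\<in>verts B. e = {a, b}")
      case True
      with r False show ?thesis by (auto simp: join2_def)
    next
      case no: False
      have "label \<Gamma> e = None"
      proof (rule ccontr)
        assume "label \<Gamma> e \<noteq> None"
        then obtain k where "label \<Gamma> e = Some k" by auto
        then have e: "e \<subseteq> verts \<Gamma>" "card e = 2" using r defining_graph_labelD by metis+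
        then obtain x y where xy: "e = {x, y}" by (auto simp: card_2_iff)
        with e r False have "x \<in> verts A \<and> y \<in> verts B \<or> y \<in> verts A \<and> x \<in> verts B" by auto
        with no xy show False by (metis insert_commute)
      qed
      with no False show ?thesis by (auto simp: join2_def)
    qed
  qed
  then show ?l using r by (cases \<Gamma>) (auto simp: join2_def)
qed

lemma join2_defining:
  assumes "defining_graph A" "defining_graph B" "verts A \<inter> verts B = {}"
  shows "defining_graph (join2 A B)"
  using join2_iff[OF assms] by blast

lemma induced_induced [simp]: "S \<subseteq> T \<Longrightarrow> induced (induced \<Gamma> T) S = induced \<Gamma> S"
  by (auto simp: induced_def fun_eq_iff)

lemma induced_self:
  assumes "defining_graph \<Gamma>"
  shows "induced \<Gamma> (verts \<Gamma>) = \<Gamma>"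
proof -
  have "label \<Gamma> e = None" if "\<not> e \<subseteq> verts \<Gamma>" for e
    using that defining_graph_labelD[OF assms, of e] by (cases "label \<Gamma> e") auto
  then have "label (induced \<Gamma> (verts \<Gamma>)) = label \<Gamma>" by (auto simp: induced_def)
  then show ?thesis by (cases \<Gamma>) (simp add: induced_def)
qed

lemma join2_split:
  assumes "defining_graph \<Gamma>" "verts \<Gamma> = S \<union> T" "S \<inter> T = {}"
    "\<And>a b. a \<in> S \<Longrightarrow> b \<in> T \<Longrightarrow> label \<Gamma> {a, b} = Some 2"
  shows "\<Gamma> = join2 (induced \<Gamma> S) (induced \<Gamma> T)"
  using assms by (subst join2_iff) (auto intro: defining_graph_induced)

lemma foldr_join2:
  assumes "\<forall>D\<in>set Ds. defining_graph D" "sorted_wrt (\<lambda>D D'. verts D \<inter> verts D' = {}) Ds"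
  shows "\<Gamma> = foldr join2 Ds empty_graph \<longleftrightarrow>
    defining_graph \<Gamma> \<and> verts \<Gamma> = (\<Union>D\<in>set Ds. verts D) \<and> (\<forall>D\<in>set Ds. D = induced \<Gamma> (verts D))
    \<and> (\<forall>D\<in>set Ds. \<forall>a\<in>verts D. \<forall>b\<in>verts \<Gamma> - verts D. label \<Gamma> {a, b} = Some 2)"
  using assms
proof (induction Ds arbitrary: \<Gamma>)
  case Nil
  then show ?case using defining_graph_empty defining_graph_verts_empty by auto
next
  case (Cons D Ds)
  let ?B = "foldr join2 Ds empty_graph"
  have B: "defining_graph ?B" "verts ?B = (\<Union>D\<in>set Ds. verts D)"
    "\<forall>D\<in>set Ds. D = induced ?B (verts D)"
    "\<forall>D\<in>set Ds. \<forall>a\<in>verts D. \<forall>b\<in>verts ?B - verts D. label ?B {a, b} = Some 2"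
    using Cons.IH[of ?B] Cons.prems by auto
  have D: "defining_graph D" using Cons.prems by simp
  have disj: "verts D \<inter> verts ?B = {}" "\<forall>D'\<in>set Ds. verts D \<inter> verts D' = {}"
    using Cons.prems B(2) by auto
  note J = join2_iff[OF D B(1) disj(1)]
  show ?case (is "?l \<longleftrightarrow> ?r")
  proof
    assume ?l
    then have *: "\<Gamma> = join2 D ?B" by simp
    note J' = iffD1[OF J *]
    have "label \<Gamma> {a, b} = Some 2"
      if D': "D' \<in> set Ds" "a \<in> verts D'" "b \<in> verts \<Gamma> - verts D'" for D' a b
    proof (cases "b \<in> verts D")
      case True
      have "a \<in> verts ?B" using that B(2) by auto
      with True J' have "label \<Gamma> {b, a} = Some 2" by blast
      then show ?thesis by (simp add: insert_commute)
    next
      case False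
      then have b: "b \<in> verts ?B" using that J' by auto
      have a: "a \<in> verts ?B" using that B(2) by auto
      have "label ?B {a, b} = Some 2" using B(4) that b by auto
      moreover have "label ?B {a, b} = label (induced \<Gamma> (verts ?B)) {a, b}" using J' by metis
      ultimately show ?thesis using a b by (simp add: induced_def)
    qed
    moreover have "D' = induced \<Gamma> (verts D')" if "D' \<in> set Ds" for D'
    proof -
      have "D' = induced (induced \<Gamma> (verts ?B)) (verts D')" using B(3) that J' by metis
      moreover have "verts D' \<subseteq> verts ?B" using B(2) that by auto
      ultimately show ?thesis by simp
    qed
    moreover have "label \<Gamma> {a, b} = Some 2" if "a \<in> verts D" "b \<in> verts \<Gamma> - verts D" for a b
      using that J' by blast
    ultimately have "(\<forall>D'\<in>set (D # Ds). D' = induced \<Gamma> (verts D'))"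
      "\<forall>D'\<in>set (D # Ds). \<forall>a\<in>verts D'. \<forall>b\<in>verts \<Gamma> - verts D'. label \<Gamma> {a, b} = Some 2"
      using J' by (metis set_ConsD)+
    then show ?r using J' B(2) by (metis UN_insert list.simps(15))
  next
    assume r: ?r
    have sub: "verts ?B \<subseteq> verts \<Gamma>" using r B(2) by auto
    have "induced \<Gamma> (verts ?B) = ?B"
    proof -
      have "label (induced \<Gamma> (verts ?B)) {a, b} = Some 2"
        if "D' \<in> set Ds" "a \<in> verts D'" "b \<in> verts ?B - verts D'" for D' a b
        using r sub that B(2) by (auto simp: induced_def)
      moreover have "D' = induced (induced \<Gamma> (verts ?B)) (verts D')" if "D' \<in> set Ds" for D'
      proof -
        have "verts D' \<subseteq> verts ?B" using that B(2) by auto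
        then show ?thesis using r that by auto
      qed
      ultimately show ?thesis
        using Cons.IH[of "induced \<Gamma> (verts ?B)"] Cons.prems B(2) r sub
        by (auto intro!: defining_graph_induced)
    qed
    moreover have "\<forall>a\<in>verts D. \<forall>b\<in>verts ?B. label \<Gamma> {a, b} = Some 2"
    proof (intro ballI)
      fix a b assume "a \<in> verts D" "b \<in> verts ?B"
      moreover from this have "b \<in> verts \<Gamma> - verts D" using sub disj(1) by blast
      ultimately show "label \<Gamma> {a, b} = Some 2" using r by (meson list.set_intros(1))
    qed
    ultimately have "\<Gamma> = join2 D ?B" unfolding J using r B(2) by auto
    then show ?l by simp
  qed
qed

lemma irreducible_decomposition_iff:
  "irreducible_decomposition \<Gamma> Ds \<longleftrightarrow> (\<forall>D\<in>set Ds. irreducible_graph D)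
    \<and> sorted_wrt (\<lambda>D D'. verts D \<inter> verts D' = {}) Ds
    \<and> defining_graph \<Gamma> \<and> verts \<Gamma> = (\<Union>D\<in>set Ds. verts D) \<and> (\<forall>D\<in>set Ds. D = induced \<Gamma> (verts D))
    \<and> (\<forall>D\<in>set Ds. \<forall>a\<in>verts D. \<forall>b\<in>verts \<Gamma> - verts D. label \<Gamma> {a, b} = Some 2)"
proof (cases "(\<forall>D\<in>set Ds. irreducible_graph D) \<and> sorted_wrt (\<lambda>D D'. verts D \<inter> verts D' = {}) Ds")
  case True
  then show ?thesis
    unfolding irreducible_decomposition_def
    by (subst foldr_join2) (auto simp: irreducible_graph_def)
qed (auto simp: irreducible_decomposition_def)

lemma irreducible_decomposition_exists:
  assumes "defining_graph \<Gamma>"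
  shows "\<exists>Ds. irreducible_decomposition \<Gamma> Ds"
  using assms
proof (induction "card (verts \<Gamma>)" arbitrary: \<Gamma> rule: less_induct)
  case less
  have fin: "finite (verts \<Gamma>)" using less.prems by (simp add: defining_graph_def)
  consider "verts \<Gamma> = {}" | "irreducible_graph \<Gamma>" | "verts \<Gamma> \<noteq> {}" "\<not> irreducible_graph \<Gamma>" by blast
  then show ?case
  proof cases
    case 1
    then have "irreducible_decomposition \<Gamma> []"
      using less.prems by (simp add: irreducible_decomposition_iff)
    then show ?thesis by blast
  next
    case 2
    then have "irreducible_decomposition \<Gamma> [\<Gamma>]"
      using less.prems by (simp add: irreducible_decomposition_iff induced_self)
    then show ?thesis by blast
  next
    case 3
    then obtain A B where AB: "defining_graph A" "defining_graph B" "verts A \<noteq> {}" "verts B \<noteq> {}"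
      "verts A \<inter> verts B = {}" "\<Gamma> = join2 A B"
      using less.prems unfolding irreducible_graph_def by blast
    note J = iffD1[OF join2_iff[OF AB(1,2,5)] AB(6)]
    have "verts A \<subset> verts \<Gamma>" "verts B \<subset> verts \<Gamma>" using AB J by auto
    then have "card (verts A) < card (verts \<Gamma>)" "card (verts B) < card (verts \<Gamma>)"
      using fin by (auto intro: psubset_card_mono)
    then obtain As Bs where "irreducible_decomposition A As" "irreducible_decomposition B Bs"
      using less.hyps AB(1,2) by blast
    note A = this(1)[unfolded irreducible_decomposition_iff]
      and B = this(2)[unfolded irreducible_decomposition_iff]
    have lab: "label A {a, b} = label \<Gamma> {a, b}" if "a \<in> verts A" "b \<in> verts A" for a b
    proof -
      have "label A {a, b} = label (induced \<Gamma> (verts A)) {a, b}" using J by metis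
      then show ?thesis using that by (simp add: induced_def)
    qed
    have lab': "label B {a, b} = label \<Gamma> {a, b}" if "a \<in> verts B" "b \<in> verts B" for a b
    proof -
      have "label B {a, b} = label (induced \<Gamma> (verts B)) {a, b}" using J by metis
      then show ?thesis using that by (simp add: induced_def)
    qed
    have ind: "D = induced \<Gamma> (verts D)" if "D \<in> set (As @ Bs)" for D
    proof (cases "D \<in> set As")
      case True
      then have "D = induced (induced \<Gamma> (verts A)) (verts D)" using A J by metis
      moreover have "verts D \<subseteq> verts A" using True A by auto
      ultimately show ?thesis by simp
    next
      case False
      then have DB: "D \<in> set Bs" using that by auto
      then have "D = induced (induced \<Gamma> (verts B)) (verts D)" using B J by metis
      moreover have "verts D \<subseteq> verts B" using DB B by auto
      ultimately show ?thesis by simp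
    qed
    have two: "label \<Gamma> {a, b} = Some 2"
      if D: "D \<in> set (As @ Bs)" and a: "a \<in> verts D" and b: "b \<in> verts \<Gamma> - verts D" for D a b
    proof (cases "D \<in> set As")
      case True
      then have aA: "a \<in> verts A" using a A by auto
      show ?thesis
      proof (cases "b \<in> verts A")
        case bA: True
        then have "label A {a, b} = Some 2" using A True a b by auto
        then show ?thesis using lab aA bA by simp
      next
        case False
        then show ?thesis using aA b J by auto
      qed
    next
      case False
      then have DB: "D \<in> set Bs" using D by auto
      then have aB: "a \<in> verts B" using a B by auto
      show ?thesis
      proof (cases "b \<in> verts B")
        case bB: True
        then have "label B {a, b} = Some 2" using B DB a b by auto
        then show ?thesis using lab' aB bB by simp
      next
        case False
        then have "label \<Gamma> {b, a} = Some 2" using aB b J by auto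
        then show ?thesis by (simp add: insert_commute)
      qed
    qed
    have disj: "verts D \<inter> verts D' = {}" if "D \<in> set As" "D' \<in> set Bs" for D D'
    proof -
      have "verts D \<subseteq> verts A" "verts D' \<subseteq> verts B" using that A B by auto
      then show ?thesis using AB(5) by auto
    qed
    have "irreducible_decomposition \<Gamma> (As @ Bs)"
      unfolding irreducible_decomposition_iff
    proof (intro conjI)
      show "\<forall>D\<in>set (As @ Bs). irreducible_graph D" using A B by auto
      show "sorted_wrt (\<lambda>D D'. verts D \<inter> verts D' = {}) (As @ Bs)"
        using A B disj by (simp add: sorted_wrt_append)
      show "verts \<Gamma> = (\<Union>D\<in>set (As @ Bs). verts D)" using A B J by auto
    qed (use less.prems ind two in blast)+
    then show ?thesis by blast
  qed
qed

lemma irreducible_decomposition_subset: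
  assumes "irreducible_decomposition \<Gamma> Ds" "irreducible_decomposition \<Gamma> Es"
  shows "set Ds \<subseteq> set Es"
proof
  note D = assms(1)[unfolded irreducible_decomposition_iff]
    and E = assms(2)[unfolded irreducible_decomposition_iff]
  have sub: "verts P \<subseteq> verts Q"
    if "irreducible_graph P" "P = induced \<Gamma> (verts P)" "verts P \<subseteq> verts \<Gamma>" "verts P \<inter> verts Q \<noteq> {}"
      "\<And>a b. a \<in> verts Q \<Longrightarrow> b \<in> verts \<Gamma> - verts Q \<Longrightarrow> label \<Gamma> {a, b} = Some 2" for P Q
  proof (rule ccontr)
    assume no: "\<not> verts P \<subseteq> verts Q"
    let ?S = "verts P \<inter> verts Q" and ?T = "verts P - verts Q"
    have P: "defining_graph P" using that by (simp add: irreducible_graph_def)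
    have "label P {a, b} = Some 2" if ab: "a \<in> ?S" "b \<in> ?T" for a b
    proof -
      have "label P {a, b} = label (induced \<Gamma> (verts P)) {a, b}"
        using \<open>P = induced \<Gamma> (verts P)\<close> by metis
      also have "\<dots> = label \<Gamma> {a, b}" using ab by (simp add: induced_def)
      finally show ?thesis using \<open>verts P \<subseteq> verts \<Gamma>\<close> that(1,2)
        \<open>\<And>a b. a \<in> verts Q \<Longrightarrow> b \<in> verts \<Gamma> - verts Q \<Longrightarrow> label \<Gamma> {a, b} = Some 2\<close> by auto
    qed
    then have "P = join2 (induced P ?S) (induced P ?T)"
      using P by (intro join2_split) auto
    moreover have "defining_graph (induced P ?S)" "defining_graph (induced P ?T)"
      using P by (auto intro: defining_graph_induced)
    moreover have "verts (induced P ?S) \<noteq> {}" "verts (induced P ?T) \<noteq> {}"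
      "verts (induced P ?S) \<inter> verts (induced P ?T) = {}"
      using that no by auto
    ultimately show False
      using \<open>irreducible_graph P\<close> unfolding irreducible_graph_def by blast
  qed
  fix P assume P: "P \<in> set Ds"
  then have Pi: "irreducible_graph P" "P = induced \<Gamma> (verts P)" "verts P \<subseteq> verts \<Gamma>"
    "\<And>a b. a \<in> verts P \<Longrightarrow> b \<in> verts \<Gamma> - verts P \<Longrightarrow> label \<Gamma> {a, b} = Some 2"
    using D by auto
  from Pi(1) obtain x where x: "x \<in> verts P" by (auto simp: irreducible_graph_def)
  then obtain Q where Q: "Q \<in> set Es" "x \<in> verts Q" using Pi(3) E by auto
  then have Qi: "irreducible_graph Q" "Q = induced \<Gamma> (verts Q)" "verts Q \<subseteq> verts \<Gamma>"
    "\<And>a b. a \<in> verts Q \<Longrightarrow> b \<in> verts \<Gamma> - verts Q \<Longrightarrow> label \<Gamma> {a, b} = Some 2"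
    using E by auto
  have "verts P \<subseteq> verts Q" using sub[OF Pi(1-3) _ Qi(4)] x Q(2) by blast
  moreover have "verts Q \<subseteq> verts P" using sub[OF Qi(1-3) _ Pi(4)] x Q(2) by blast
  ultimately have "P = Q" using Pi(2) Qi(2) by (metis subset_antisym)
  then show "P \<in> set Es" using Q(1) by simp
qed

lemma irreducible_factors_eq:
  assumes "irreducible_decomposition \<Gamma> Ds"
  shows "irreducible_factors \<Gamma> = set Ds"
  unfolding irreducible_factors_def
proof (rule the_equality)
  show "\<exists>Ds'. irreducible_decomposition \<Gamma> Ds' \<and> set Ds = set Ds'" using assms by blast
  show "F = set Ds" if "\<exists>Ds. irreducible_decomposition \<Gamma> Ds \<and> F = set Ds" for F
    using that irreducible_decomposition_subset assms by (metis subset_antisym)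
qed


section \<open>The Center Conjecture\<close>

definition satisfies_center_conjecture :: "'a lgraph \<Rightarrow> bool" where
  "satisfies_center_conjecture \<Gamma> \<longleftrightarrow>
    (artin_group \<Gamma>)\<lparr>carrier := center (artin_group \<Gamma>)\<rparr> \<cong>
      product_group {..<card {D \<in> irreducible_factors \<Gamma>. spherical D}} (\<lambda>_. integer_group)"

end

theory Submission
  imports Defs Complex_Main
begin

text \<open>Let \<open>u\<close> and \<open>u'\<close> be non-adjacent vertices. Every relation avoids one of them, so the Artin group is
  the amalgam of the subgroups generated by \<open>V - {u}\<close> and \<open>V - {u'}\<close> along the one generated by
  \<open>V - {u, u'}\<close>, and the center lies in the latter. Standard parabolic subgroups satisfy
  \<open>\<langle>X\<rangle> \<inter> \<langle>Y\<rangle> = \<langle>X \<inter> Y\<rangle>\<close>, by the set-theoretic retraction onto \<open>\<langle>Y\<rangle>\<close> of Charney--Paris and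
  Godelle--Paris, which reads off the letters along a path of minimal coset representatives in the
  Coxeter group. As every vertex other than the cone point \<open>t\<close> has a non-neighbour, the center lies in
  \<open>\<langle>t\<rangle>\<close>. If \<open>m\<^sub>s\<^sub>t \<noteq> 2\<close> for some \<open>s\<close>, the retraction onto \<open>\<langle>t\<rangle>\<close> shows that no nontrivial power of
  \<open>t\<close> commutes with \<open>s\<close>. An irreducible factor containing a vertex other than \<open>t\<close> contains a
  non-adjacent pair, so its Coxeter group is infinite.\<close>

text \<open>A central \<open>z\<close> outside the edge group lies on one side of the base edge of
  the Bass--Serre tree. One of \<open>u\<close>, \<open>u'\<close>, multiplied on the left, throws
  it to the other side; multiplied on the right, the same letter keeps it where it was. The sides
  are read off words by \<open>cross\<close>. The Coxeter group enters through linear maps. A letter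
  \<open>s\<close> read at a minimal representative \<open>d\<close> either leads to the minimal
  representative \<open>d s\<close>, or satisfies \<open>d s = y d\<close> with \<open>y\<close> in
  \<open>Y\<close> and is output as \<open>y\<close>; the second case means that \<open>d\<close>
  maps the simple root of \<open>s\<close> to that of \<open>y\<close>. The obstacle is invariance
  under braid relations. Along an alternating word of length \<open>m\<close> the tests run through
  all positive roots of a dihedral group, and either none of them, exactly one, or both simple ones
  must go to simple roots of \<open>Y\<close>. Chebyshev numbers are the coordinates of these roots,
  so that this becomes a question of signs. On a word over \<open>X\<close> the map \<open>d\<close>
  stays in the group generated by \<open>X\<close>, which forces the outputs into \<open>X\<close>;
  hence the formula for intersections.\<close>

lemma words_mono: "X \<subseteq> Y \<Longrightarrow> w \<in> words X \<Longrightarrow> w \<in> words Y"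
  by (auto simp: words_def)

lemma words_iff_fst: "w \<in> words X \<longleftrightarrow> fst ` set w \<subseteq> X"
  by (induction w) auto

text \<open>A process that reads letters descends to the presented group once it respects
  cancellations and relations. \<open>Rel\<close> is only symmetric and transitive, so that
  \<open>Rel p p\<close> can carry an invariant of the states.\<close>

lemma fold_word_equiv:
  assumes sym: "\<And>p q. Rel p q \<Longrightarrow> Rel q p"
    and trans: "\<And>p q r. Rel p q \<Longrightarrow> Rel q r \<Longrightarrow> Rel p r"
    and step: "\<And>a p q. fst a \<in> X \<Longrightarrow> Rel p q \<Longrightarrow> Rel (st a p) (st a q)"
    and cancel: "\<And>x b p. x \<in> X \<Longrightarrow> Rel p p \<Longrightarrow> Rel (st (x, \<not> b) (st (x, b) p)) p"
    and rel: "\<And>l r p. (l, r) \<in> R \<Longrightarrow> l \<in> words X \<Longrightarrow> r \<in> words X \<Longrightarrow> Rel p p \<Longrightarrow>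
      Rel (fold st l p) (fold st r p)"
    and eq: "word_equiv X R w w'" and p: "Rel p p"
  shows "Rel (fold st w p) (fold st w' p)"
proof -
  have cong: "Rel (fold st w p) (fold st w q)" if "w \<in> words X" "Rel p q" for w p q
    using that by (induction w arbitrary: p q) (auto intro: step)
  show ?thesis using eq p
  proof (induction arbitrary: p rule: word_equiv.induct)
    case (cancel u v x b)
    have "Rel (fold st u p) (fold st u p)" using cong cancel by blast
    then have "Rel (st (x, \<not> b) (st (x, b) (fold st u p))) (fold st u p)"
      using assms(4) cancel by blast
    then show ?case using cong cancel by simp
  next
    case (relation u v l r)
    then show ?case using cong rel by simp
  next
    case (refl w)
    then show ?case using cong by blast
  qed (blast intro: sym trans)+
qed

lemma inv_word_inv_word [simp]: "inv_word (inv_word w) = w"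
  by (induction w) (auto simp: inv_word_def)

lemma inv_word_cancel': "w \<in> words X \<Longrightarrow> word_equiv X R (w @ inv_word w) []"
  using inv_word_cancel[of "inv_word w" X R] by (simp add: inv_word_words)

lemma alt_word_words: "alt_word k s t \<in> words X" if "s \<in> X" "t \<in> X"
  using that by (induction k s t rule: alt_word.induct) auto

lemma length_alt_word [simp]: "length (alt_word k s t) = k"
  by (induction k s t rule: alt_word.induct) auto

section \<open>Words modulo the Artin relations and subgroups generated by vertices\<close>

locale artin =
  fixes \<Gamma> :: "'a lgraph"
  assumes defining: "defining_graph \<Gamma>"
begin

abbreviation V where "V \<equiv> verts \<Gamma>"

abbreviation artin_eq (infix "\<simeq>" 50) where
  "u \<simeq> v \<equiv> word_equiv V (artin_relations \<Gamma>) u v"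

lemma eqD: "u \<simeq> v \<Longrightarrow> u \<in> words V" "u \<simeq> v \<Longrightarrow> v \<in> words V"
  using word_equiv_words by blast+

lemmas eq_refl = word_equiv.refl[of _ V "artin_relations \<Gamma>"]
  and eq_sym = word_equiv.sym[of V "artin_relations \<Gamma>"]
  and eq_trans [trans] = word_equiv.trans[of V "artin_relations \<Gamma>"]
  and eq_append = word_equiv_append2[of V "artin_relations \<Gamma>"]

lemma labelD:
  assumes "label \<Gamma> {s, t} = Some k"
  shows "s \<in> V" "t \<in> V" "s \<noteq> t" "2 \<le> k"
proof -
  have *: "{s, t} \<subseteq> V" "card {s, t} = 2" "2 \<le> k"
    using defining_graph_labelD[OF defining assms] by auto
  then show "s \<in> V" "t \<in> V" "2 \<le> k" by auto
  show "s \<noteq> t" using *(2) by auto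
qed

lemma finite_V [simp]: "finite V"
  using defining by (simp add: defining_graph_def)

lemma braid_eq:
  assumes "label \<Gamma> {s, t} = Some k"
  shows "alt_word k s t \<simeq> alt_word k t s"
proof -
  have "(alt_word k s t, alt_word k t s) \<in> artin_relations \<Gamma>"
    using assms unfolding artin_relations_def by blast
  from word_equiv.relation[OF _ _ _ _ this, of "[]" V "[]"] labelD[OF assms]
  show ?thesis by (simp add: alt_word_words)
qed

lemma eq_cancel_left: "\<lbrakk>u @ v \<simeq> w\<rbrakk> \<Longrightarrow> v \<simeq> inv_word u @ w"
proof -
  assume *: "u @ v \<simeq> w"
  then have uv: "u \<in> words V" "v \<in> words V" using eqD(1) by fastforce+
  have "inv_word u @ u @ v \<simeq> inv_word u @ w"
    using * uv by (intro eq_append eq_refl inv_word_words)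
  moreover have "(inv_word u @ u) @ v \<simeq> [] @ v"
    using uv by (intro eq_append eq_refl inv_word_cancel)
  ultimately show ?thesis using eq_sym eq_trans by (metis append.assoc append_Nil)
qed

lemma eq_cancel_right: "u @ v \<simeq> w \<Longrightarrow> u \<simeq> w @ inv_word v"
proof -
  assume *: "u @ v \<simeq> w"
  then have uv: "u \<in> words V" "v \<in> words V" using eqD(1) by fastforce+
  have "(u @ v) @ inv_word v \<simeq> w @ inv_word v"
    using * uv by (intro eq_append eq_refl inv_word_words)
  moreover have "u @ v @ inv_word v \<simeq> u @ []"
    using uv by (intro eq_append eq_refl inv_word_cancel')
  ultimately show ?thesis using eq_sym eq_trans by (metis append.assoc append_Nil2)
qed

definition in_gen :: "'a set \<Rightarrow> 'a word \<Rightarrow> bool" where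
  "in_gen X w \<longleftrightarrow> (\<exists>c\<in>words X. w \<simeq> c)"

lemma in_gen_cong: "u \<simeq> v \<Longrightarrow> in_gen X u \<longleftrightarrow> in_gen X v"
  unfolding in_gen_def using eq_sym eq_trans by blast

lemma in_gen_base: "X \<subseteq> V \<Longrightarrow> w \<in> words X \<Longrightarrow> in_gen X w"
  unfolding in_gen_def using eq_refl words_mono by blast

lemma in_gen_append: "in_gen X u \<Longrightarrow> in_gen X v \<Longrightarrow> in_gen X (u @ v)"
  unfolding in_gen_def using eq_append words_append by metis

lemma in_gen_append_iff:
  assumes "X \<subseteq> V" "v \<in> words X"
  shows "in_gen X (u @ v) \<longleftrightarrow> in_gen X u"
proof
  assume "in_gen X (u @ v)"
  then obtain c where c: "c \<in> words X" "u @ v \<simeq> c" unfolding in_gen_def by blast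
  then have "u \<simeq> c @ inv_word v" by (intro eq_cancel_right)
  then show "in_gen X u" unfolding in_gen_def using c(1) assms inv_word_words words_append by metis
next
  assume "in_gen X u"
  then show "in_gen X (u @ v)" by (rule in_gen_append[OF _ in_gen_base[OF assms]])
qed

section \<open>Central elements and non-adjacent vertices\<close>

text \<open>\<open>cross\<close> is the signed number of times that the path of prefixes of a word crosses, by a letter \<open>u'\<close>,
  the edge of the Bass--Serre tree whose stabilizer is \<open>C\<close>.\<close>

definition cross_step :: "('a word \<Rightarrow> bool) \<Rightarrow> 'a \<Rightarrow> 'a \<times> bool \<Rightarrow> 'a word \<times> int \<Rightarrow> 'a word \<times> int" where
  "cross_step C u' a = (\<lambda>(p, i). (p @ [a],
     if fst a = u' then i + of_bool (C (p @ [a])) - of_bool (C p) else i))"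

definition cross :: "('a word \<Rightarrow> bool) \<Rightarrow> 'a \<Rightarrow> 'a word \<Rightarrow> int" where
  "cross C u' w = snd (fold (cross_step C u') w ([], 0))"

lemma fst_cross_step: "fst (fold (cross_step C u') w (p, i)) = p @ w"
  by (induction w arbitrary: p i) (auto simp: cross_step_def)

lemma cross_Nil [simp]: "cross C u' [] = 0"
  by (simp add: cross_def)

lemma cross_snoc:
  "cross C u' (w @ [a]) =
    (if fst a = u' then cross C u' w + of_bool (C (w @ [a])) - of_bool (C w) else cross C u' w)"
proof -
  obtain p i where p: "fold (cross_step C u') w ([], 0) = (p, i)" by fastforce
  moreover have "p = w" using fst_cross_step[of C u' w "[]" 0] p by simp
  ultimately show ?thesis by (simp add: cross_def cross_step_def)
qed

context
  fixes u u' :: 'a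
  assumes u: "u \<in> V" "u' \<in> V" "u \<noteq> u'" and nonadj: "label \<Gamma> {u, u'} = None"
begin

private abbreviation C where "C \<equiv> in_gen (V - {u, u'})"
private abbreviation F where "F \<equiv> cross C u'"

lemma fold_cross_no:
  assumes "w \<in> words (V - {u'})"
  shows "fold (cross_step C u') w (p, i) = (p @ w, i)"
  using assms by (induction w arbitrary: p) (auto simp: cross_step_def)

text \<open>Letters other than \<open>u'\<close> are now generators of the edge group and do not
  affect membership in \<open>C\<close>, so the increments telescope.\<close>

lemma fold_cross_yes:
  assumes "w \<in> words (V - {u})"
  shows "fold (cross_step C u') w (p, i) = (p @ w, i + of_bool (C (p @ w)) - of_bool (C p))"
  using assms
proof (induction w arbitrary: p i)
  case (Cons a w)
  have "C (p @ [a]) = C p" if "fst a \<noteq> u'"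
    using that Cons.prems by (intro in_gen_append_iff) auto
  then show ?case using Cons by (auto simp: cross_step_def)
qed auto

text \<open>Since \<open>u\<close> and \<open>u'\<close> are not adjacent, a relation avoids one of
  them. If it avoids \<open>u'\<close>, nothing is counted; if it avoids \<open>u\<close>, the count
  depends only on the endpoints, which both sides share.\<close>

lemma cross_eq:
  assumes "w \<simeq> w'"
  shows "F w = F w'"
proof -
  define Rel where "Rel = (\<lambda>(p, i::int) (q, j). p \<simeq> q \<and> i = j)"
  have "Rel (fold (cross_step C u') w ([], 0)) (fold (cross_step C u') w' ([], 0))"
  proof (rule fold_word_equiv[OF _ _ _ _ _ assms])
    fix p q assume "Rel p q"
    then show "Rel q p" by (auto simp: Rel_def intro: eq_sym)
  next
    fix p q r assume "Rel p q" "Rel q r"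
    then show "Rel p r" by (auto simp: Rel_def intro: eq_trans)
  next
    fix a :: "'a \<times> bool" and p q :: "'a word \<times> int" assume a: "fst a \<in> V" and pq: "Rel p q"
    obtain p1 i q1 where *: "p = (p1, i)" "q = (q1, i)" "p1 \<simeq> q1"
      using pq by (auto simp: Rel_def)
    have "p1 @ [a] \<simeq> q1 @ [a]" using * a by (intro eq_append eq_refl) auto
    then show "Rel (cross_step C u' a p) (cross_step C u' a q)"
      using * in_gen_cong by (auto simp: Rel_def cross_step_def)
  next
    fix x b and p :: "'a word \<times> int" assume x: "x \<in> V" and pp: "Rel p p"
    obtain p1 i where p: "p = (p1, i)" by (cases p)
    have p1: "p1 \<in> words V" using pp p eqD by (auto simp: Rel_def)
    have "p1 @ [(x, b), (x, \<not> b)] @ [] \<simeq> p1 @ []" using p1 x by (intro word_equiv.cancel) auto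
    then have *: "p1 @ [(x, b), (x, \<not> b)] \<simeq> p1" by simp
    show "Rel (cross_step C u' (x, \<not> b) (cross_step C u' (x, b) p)) p"
      using * in_gen_cong[OF *] by (auto simp: p Rel_def cross_step_def)
  next
    fix l r and p :: "'a word \<times> int" assume lr: "(l, r) \<in> artin_relations \<Gamma>" and pp: "Rel p p"
    obtain p1 i where p: "p = (p1, i)" by (cases p)
    have p1: "p1 \<in> words V" using pp p eqD by (auto simp: Rel_def)
    obtain k s t where lab: "label \<Gamma> {s, t} = Some k" "l = alt_word k s t" "r = alt_word k t s"
      using lr unfolding artin_relations_def by blast
    have st: "s \<in> V" "t \<in> V" using labelD[OF lab(1)] by auto
    have *: "p1 @ l \<simeq> p1 @ r"
      unfolding lab using p1 braid_eq[OF lab(1)] by (intro eq_append eq_refl)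
    have "{s, t} \<subseteq> V - {u'} \<or> {s, t} \<subseteq> V - {u}"
      using nonadj lab(1) st u(3) by (auto simp: insert_commute)
    then have "(l \<in> words (V - {u'}) \<and> r \<in> words (V - {u'})) \<or>
        (l \<in> words (V - {u}) \<and> r \<in> words (V - {u}))"
      unfolding lab by (auto intro: alt_word_words)
    then show "Rel (fold (cross_step C u') l p) (fold (cross_step C u') r p)"
      using * in_gen_cong[OF *] by (auto simp: p Rel_def fold_cross_no fold_cross_yes)
  qed (auto simp: Rel_def eq_refl)
  then show ?thesis by (auto simp: Rel_def cross_def split: prod.splits)
qed

lemma cross_append_no: "w \<in> words (V - {u'}) \<Longrightarrow> F (p @ w) = F p"
  using fold_cross_no[of w] unfolding cross_def
  by (cases "fold (cross_step C u') p ([], 0)") auto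

lemma cross_C: "C w \<Longrightarrow> F w = 0"
proof -
  assume "C w"
  then obtain c where c: "c \<in> words (V - {u, u'})" "w \<simeq> c" unfolding in_gen_def by blast
  have "F ([] @ c) = F []"
    by (rule cross_append_no) (rule words_mono[OF _ c(1)], auto)
  then show ?thesis using cross_eq[OF c(2)] by simp
qed

text \<open>The count is back at \<open>0\<close> whenever the path is in \<open>C\<close>. Outside
  \<open>C\<close>, the value \<open>-1\<close> records that the last departure was by
  \<open>u'\<close>, and \<open>0\<close> that it was by \<open>u\<close>.\<close>

lemma cross_range: "w \<in> words V \<Longrightarrow> F w \<in> {0, -1}"
proof (induction w rule: rev_induct)
  case (snoc a w)
  then have IH: "F w \<in> {0, -1}" by auto
  show ?case
  proof (cases "C (w @ [a])")
    case True
    then show ?thesis using cross_C by simp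
  next
    case False
    then show ?thesis using IH cross_C[of w] by (auto simp: cross_snoc)
  qed
qed auto

text \<open>Only \<open>u\<close> and \<open>u'\<close> change membership in \<open>C\<close>; the
  two counts together telescope from the empty word, which lies in \<open>C\<close>.\<close>

lemma cross_swap:
  assumes "w \<in> words V"
  shows "F w + cross C u w = of_bool (C w) - 1"
  using assms
proof (induction w rule: rev_induct)
  case Nil
  have "C []" by (intro in_gen_base) auto
  then show ?case by simp
next
  case (snoc a w)
  have "C (w @ [a]) = C w" if "fst a \<noteq> u" "fst a \<noteq> u'"
    using that snoc.prems by (intro in_gen_append_iff) auto
  then show ?case using snoc u(3) by (auto simp: cross_snoc)
qed

text \<open>Left translation by \<open>k\<close> moves the edge \<open>C\<close> to an edge on its other side.\<close>

lemma cross_translate: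
  assumes k: "k \<in> words (V - {u'})" "\<not> C k"
    and w: "w \<in> words V" "F w = -1 \<or> C w"
  shows "F (k @ w) = 0 \<and> \<not> C (k @ w)"
  using w
proof (induction w rule: rev_induct)
  case Nil
  then show ?case using k cross_append_no[of k "[]"] by simp
next
  case (snoc a w)
  have kV: "k \<in> words V" using k(1) by (rule words_mono[rotated]) auto
  have c_case: "F (k @ v) = 0 \<and> \<not> C (k @ v)" if v: "C v" for v
  proof
    obtain c where c: "c \<in> words (V - {u, u'})" "v \<simeq> c" using v unfolding in_gen_def by blast
    have eq: "k @ v \<simeq> k @ c" using c kV by (intro eq_append eq_refl)
    have c': "k @ c \<in> words (V - {u'})" using k(1) words_mono[OF _ c(1), of "V - {u'}"] by auto
    show "F (k @ v) = 0"
      using cross_eq[OF eq] cross_append_no[OF c', of "[]"] by simp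
    have "C (k @ c) = C k" using c by (intro in_gen_append_iff) auto
    then show "\<not> C (k @ v)" using in_gen_cong[OF eq] k(2) by simp
  qed
  show ?case
  proof (cases "C (w @ [a])")
    case True
    then show ?thesis using c_case by blast
  next
    case False
    then have F: "F (w @ [a]) = -1" using snoc.prems by simp
    \<comment> \<open>Otherwise \<open>w @ [a]\<close> would lie in the translate of
      \<open>C\<close> by the inverse of \<open>k\<close>, hence in the subgroup of
      \<open>V - {u'}\<close>, where \<open>cross\<close> vanishes.\<close>
    have notC: "\<not> C (k @ w @ [a])"
    proof
      assume "C (k @ w @ [a])"
      then obtain c where c: "c \<in> words (V - {u, u'})" "k @ w @ [a] \<simeq> c"
        unfolding in_gen_def by blast
      have "w @ [a] \<simeq> inv_word k @ c" using c(2) by (rule eq_cancel_left)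
      moreover have "inv_word k @ c \<in> words (V - {u'})"
        using k(1) inv_word_words words_mono[OF _ c(1), of "V - {u'}"] by auto
      ultimately have "F (w @ [a]) = 0" using cross_eq cross_append_no[of "inv_word k @ c" "[]"] by simp
      then show False using F by simp
    qed
    have "F w = -1 \<or> C w"
      using F False by (auto simp: cross_snoc split: if_splits)
    then have "F (k @ w) = 0 \<and> \<not> C (k @ w)" using snoc by auto
    then have "F (k @ w @ [a]) = 0"
      using notC cross_snoc[of C u' "k @ w" a] by auto
    then show ?thesis using notC by simp
  qed
qed

end

text \<open>Left multiplication by \<open>u\<close> would change the count from \<open>-1\<close> to
  \<open>0\<close>, whereas a letter \<open>u\<close> appended on the right is never
  counted.\<close>

lemma central_cross_aux:
  assumes u: "u \<in> V" "u' \<in> V" "u \<noteq> u'" "label \<Gamma> {u, u'} = None"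
    and z: "z \<in> words V" "[(u, True)] @ z \<simeq> z @ [(u, True)]"
    and "\<not> in_gen (V - {u, u'}) [(u, True)]"
  shows "cross (in_gen (V - {u, u'})) u' z \<noteq> -1"
proof
  let ?F = "cross (in_gen (V - {u, u'})) u'"
  assume F: "?F z = -1"
  have "?F ([(u, True)] @ z) = 0"
    using cross_translate[OF u, of "[(u, True)]" z] F z assms(7) u by auto
  moreover have "?F ([(u, True)] @ z) = ?F (z @ [(u, True)])"
    by (rule cross_eq[OF u z(2)])
  moreover have "?F (z @ [(u, True)]) = ?F z"
    using u by (intro cross_append_no) auto
  ultimately show False using F by simp
qed

lemma central_in_gen:
  assumes u: "u \<in> V" "u' \<in> V" "u \<noteq> u'" "label \<Gamma> {u, u'} = None"
    and z: "z \<in> words V" "\<And>v. v \<in> V \<Longrightarrow> [(v, True)] @ z \<simeq> z @ [(v, True)]"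
    and C: "\<not> in_gen (V - {u, u'}) [(u, True)]" "\<not> in_gen (V - {u, u'}) [(u', True)]"
  shows "in_gen (V - {u, u'}) z"
proof (rule ccontr)
  assume no: "\<not> in_gen (V - {u, u'}) z"
  have comm: "{u', u} = {u, u'}" by auto
  have "cross (in_gen (V - {u, u'})) u' z \<noteq> -1"
    by (rule central_cross_aux) (use u z C in auto)
  moreover have "cross (in_gen (V - {u', u})) u z \<noteq> -1"
    by (rule central_cross_aux) (use u z C in \<open>auto simp: comm\<close>)
  \<comment> \<open>Outside \<open>C\<close> the two counts add up to \<open>-1\<close> and lie in
    \<open>{0, -1}\<close>, so one of them is \<open>-1\<close>.\<close>
  ultimately show False
    using cross_swap[OF u z(1)] cross_range[OF u z(1)] no unfolding comm by auto
qed

end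

section \<open>Chebyshev numbers\<close>

fun cheb :: "real \<Rightarrow> nat \<Rightarrow> real" where
  "cheb c 0 = 0"
| "cheb c (Suc 0) = 1"
| "cheb c (Suc (Suc n)) = 2 * c * cheb c (Suc n) - cheb c n"

text \<open>This identifies \<open>cheb c n\<close> as the Chebyshev polynomial of the second kind
  of degree \<open>n - 1\<close>; the shift makes it vanish at index \<open>0\<close>.\<close>

lemma cheb_sin: "sin \<theta> * cheb (cos \<theta>) n = sin (real n * \<theta>)"
proof (induction "cos \<theta>" n rule: cheb.induct)
  case (3 n)
  have "sin (real (Suc (Suc n)) * \<theta>) + sin (real n * \<theta>) = 2 * cos \<theta> * sin (real (Suc n) * \<theta>)"
  proof -
    have "real (Suc (Suc n)) * \<theta> = real (Suc n) * \<theta> + \<theta>" "real n * \<theta> = real (Suc n) * \<theta> - \<theta>"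
      by (simp_all add: algebra_simps)
    then show ?thesis by (simp only: sin_add sin_diff) simp
  qed
  then show ?case using 3 by (simp add: algebra_simps)
qed auto

lemma cheb_one: "cheb 1 n = real n"
  by (induction "1::real" n rule: cheb.induct) auto

text \<open>By the recurrence the left side does not depend on \<open>i\<close>; at
  \<open>i = 0\<close> it is \<open>cheb c k\<close>.\<close>

lemma cheb_d_Ocagne: "cheb c (i + k) * cheb c (Suc i) - cheb c i * cheb c (Suc (i + k)) = cheb c k"
  by (induction i) (auto simp: algebra_simps)

context
  fixes m :: nat and c :: real
  assumes m: "2 \<le> m" and c: "c = cos (pi / m)"
begin

lemma sin_pi_div_pos: "0 < sin (pi / m)"
proof (rule sin_gt_zero)
  show "pi / m < pi" using m by (simp add: divide_less_eq)
qed (use m in auto)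

lemma cheb_pos: "0 < j \<Longrightarrow> j < m \<Longrightarrow> 0 < cheb c j"
proof -
  assume j: "0 < j" "j < m"
  have "0 < sin (real j * (pi / m))"
  proof (rule sin_gt_zero)
    show "0 < real j * (pi / m)" using j by simp
    have "real j * pi < real m * pi" using j by simp
    then show "real j * (pi / m) < pi" using j by (simp add: divide_less_eq mult.commute)
  qed
  then have "0 < sin (pi / m) * cheb c j" unfolding c cheb_sin .
  then show ?thesis using sin_pi_div_pos by (simp add: zero_less_mult_iff)
qed

lemma cheb_reflect: "j \<le> m \<Longrightarrow> cheb c (m - j) = cheb c j"
proof -
  assume j: "j \<le> m"
  have "real (m - j) * (pi / m) = pi - real j * (pi / m)" using j m by (simp add: of_nat_diff field_simps)
  then have "sin (pi / m) * cheb c (m - j) = sin (pi / m) * cheb c j"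
    unfolding c cheb_sin by simp
  then show ?thesis using sin_pi_div_pos by simp
qed

lemma cheb_m: "cheb c m = 0" "cheb c (Suc m) = -1" "cheb c (m - 1) = 1"
proof -
  show 0: "cheb c m = 0" using cheb_reflect[of 0] by simp
  show 1: "cheb c (m - 1) = 1" using cheb_reflect[of 1] m by simp
  obtain n where "m = Suc n" using m by (cases m) auto
  then show "cheb c (Suc m) = -1" using 0 1 by simp
qed

lemma cheb_nonneg: "j \<le> m \<Longrightarrow> 0 \<le> cheb c j"
  using cheb_pos[of j] cheb_m by (cases "j = 0"; cases "j = m") auto

lemma cos_pi_div: "0 \<le> c" "c < 1"
proof -
  have "pi / m \<le> pi / 2" using m by (intro divide_left_mono) auto
  moreover have "- (pi / 2) \<le> 0" "0 \<le> pi / m" by auto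
  ultimately show "0 \<le> c" unfolding c by (intro cos_ge_zero) linarith+
  have "c \<noteq> 1" using cheb_one[of m] cheb_m(1) m by auto
  then show "c < 1" using c by (simp add: order_less_le)
qed

end

text \<open>This recovers a label from the value of the bilinear form.\<close>

lemma cos_pi_div_inj:
  assumes "cos (pi / real m) = cos (pi / real n)" "2 \<le> m" "2 \<le> n"
  shows "m = n"
proof -
  have "0 \<le> pi / k \<and> pi / k \<le> pi" if "2 \<le> k" for k :: nat
    using that by (simp add: divide_le_eq)
  then have "pi / m = pi / n"
    using assms cos_inj_pi[of "pi / m" "pi / n"] by blast
  then show ?thesis using assms by simp
qed

section \<open>Vectors and alternating words\<close>

definition lincomb :: "real \<Rightarrow> ('a \<Rightarrow> real) \<Rightarrow> real \<Rightarrow> ('a \<Rightarrow> real) \<Rightarrow> 'a \<Rightarrow> real" where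
  "lincomb a f b g = (\<lambda>x. a * f x + b * g x)"

definition unit_vec :: "'a \<Rightarrow> 'a \<Rightarrow> real" where
  "unit_vec x = (\<lambda>y. of_bool (y = x))"

definition nonneg :: "('a \<Rightarrow> real) \<Rightarrow> bool" where
  "nonneg f \<longleftrightarrow> (\<forall>x. 0 \<le> f x)"

definition neg :: "('a \<Rightarrow> real) \<Rightarrow> 'a \<Rightarrow> real" where
  "neg f = (\<lambda>x. - f x)"

lemma neg_neg [simp]: "neg (neg f) = f"
  by (simp add: neg_def)

lemma unit_vec_inj [simp]: "unit_vec x = unit_vec y \<longleftrightarrow> x = y"
  by (auto simp: unit_vec_def fun_eq_iff)

lemma nonneg_unit_vec [simp]: "nonneg (unit_vec x)"
  by (simp add: nonneg_def unit_vec_def)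

lemma not_nonneg_neg_unit_vec: "\<not> nonneg (neg (unit_vec x))"
  by (auto simp: nonneg_def unit_vec_def neg_def intro!: exI[of _ x])

lemma nonneg_lincomb: "nonneg f \<Longrightarrow> nonneg g \<Longrightarrow> 0 \<le> a \<Longrightarrow> 0 \<le> b \<Longrightarrow> nonneg (lincomb a f b g)"
  by (simp add: nonneg_def lincomb_def)

lemma lincomb_lincomb:
  "lincomb p (lincomb a f b g) q (lincomb a' f b' g) = lincomb (p * a + q * a') f (p * b + q * b') g"
  by (auto simp: lincomb_def algebra_simps)

lemma neg_lincomb: "neg f = lincomb (-1) f 0 f"
  by (simp add: lincomb_def neg_def)

abbreviation alt :: "nat \<Rightarrow> 'a \<Rightarrow> 'a \<Rightarrow> 'a list" where
  "alt k s t \<equiv> map fst (alt_word k s t)"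

lemma alt_snoc: "alt (Suc k) s t = alt k s t @ [if even k then s else t]"
  by (induction k arbitrary: s t) auto

lemma set_alt: "set (alt k s t) \<subseteq> {s, t}"
  by (induction k arbitrary: s t) auto

lemma set_alt_subset: "s \<in> X \<Longrightarrow> t \<in> X \<Longrightarrow> set (alt k s t) \<subseteq> X"
  by (induction k arbitrary: s t) auto

lemma alt_add: "\<exists>r. alt (m + j) s t = alt m s t @ r \<and> length r = j \<and> set r \<subseteq> {s, t}"
proof (induction m arbitrary: s t)
  case 0
  show ?case using set_alt[of j s t] by (auto intro: exI[of _ "alt j s t"])
next
  case (Suc m)
  from Suc.IH[of t s] show ?case by auto
qed

lemma rev_alt: "rev (alt k s t) = (if odd k then alt k s t else alt k t s)"
proof (induction k arbitrary: s t)
  case (Suc k)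
  have "rev (alt (Suc k) s t) = rev (alt k t s) @ [s]" by simp
  then show ?case unfolding Suc[of t s] alt_snoc by auto
qed auto

section \<open>The geometric representation\<close>

context artin
begin

text \<open>The Tits form on simple roots; the value \<open>-1\<close> at a missing edge is the
  limit of \<open>- cos (pi / m)\<close>.\<close>

definition bil :: "'a \<Rightarrow> 'a \<Rightarrow> real" where
  "bil s t = (if s = t then 1 else case label \<Gamma> {s, t} of Some m \<Rightarrow> - cos (pi / m) | None \<Rightarrow> -1)"

definition pairing :: "'a \<Rightarrow> ('a \<Rightarrow> real) \<Rightarrow> real" where
  "pairing s f = (\<Sum>y\<in>V. bil s y * f y)"

definition form :: "('a \<Rightarrow> real) \<Rightarrow> ('a \<Rightarrow> real) \<Rightarrow> real" where
  "form f g = (\<Sum>x\<in>V. f x * pairing x g)"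

definition reflect :: "'a \<Rightarrow> ('a \<Rightarrow> real) \<Rightarrow> 'a \<Rightarrow> real" where
  "reflect s f = f(s := f s - 2 * pairing s f)"

lemma bil_refl [simp]: "bil s s = 1"
  by (simp add: bil_def)

lemma bil_sym: "bil s t = bil t s"
  by (simp add: bil_def insert_commute)

lemma pairing_lincomb: "pairing s (lincomb a f b g) = a * pairing s f + b * pairing s g"
  by (simp add: pairing_def lincomb_def algebra_simps sum.distrib sum_distrib_left)

lemma pairing_unit_vec [simp]: "t \<in> V \<Longrightarrow> pairing s (unit_vec t) = bil s t"
  by (simp add: pairing_def unit_vec_def if_distrib of_bool_def cong: if_cong)

lemma reflect_eq: "reflect s f = lincomb 1 f (- 2 * pairing s f) (unit_vec s)"
  by (auto simp: reflect_def lincomb_def unit_vec_def)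

lemma reflect_other: "x \<noteq> s \<Longrightarrow> reflect s f x = f x"
  by (simp add: reflect_def)

lemma reflect_lincomb: "reflect s (lincomb a f b g) = lincomb a (reflect s f) b (reflect s g)"
  unfolding reflect_eq pairing_lincomb by (auto simp: lincomb_def algebra_simps)

lemma pairing_reflect: "s \<in> V \<Longrightarrow> pairing t (reflect s f) = pairing t f - 2 * bil t s * pairing s f"
  unfolding reflect_eq pairing_lincomb by simp

lemma reflect_reflect [simp]: "s \<in> V \<Longrightarrow> reflect s (reflect s f) = f"
  by (subst reflect_def) (auto simp: pairing_reflect, auto simp: reflect_def)

lemma reflect_comp_reflect [simp]: "s \<in> V \<Longrightarrow> reflect s \<circ> reflect s = id"
  by (auto simp: fun_eq_iff)

lemma reflect_unit_vec: "s \<in> V \<Longrightarrow> reflect s (unit_vec s) = neg (unit_vec s)"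
  by (auto simp: reflect_eq lincomb_def neg_def)

lemma form_sym: "form f g = form g f"
proof -
  have "form f g = (\<Sum>x\<in>V. \<Sum>y\<in>V. f x * (bil x y * g y))"
    by (simp add: form_def pairing_def sum_distrib_left)
  also have "\<dots> = (\<Sum>y\<in>V. \<Sum>x\<in>V. f x * (bil x y * g y))" by (rule sum.swap)
  also have "\<dots> = form g f"
    by (simp add: form_def pairing_def sum_distrib_left bil_sym mult_ac)
  finally show ?thesis .
qed

lemma form_lincomb: "form f (lincomb a g b h) = a * form f g + b * form f h"
  by (simp add: form_def pairing_lincomb algebra_simps sum.distrib sum_distrib_left)

lemma form_lincomb': "form (lincomb a g b h) f = a * form g f + b * form h f"
  using form_lincomb form_sym by metis

lemma form_unit_vec: "s \<in> V \<Longrightarrow> form (unit_vec s) f = pairing s f"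
proof -
  assume "s \<in> V"
  moreover have "form (unit_vec s) f = (\<Sum>x\<in>V. if x = s then pairing x f else 0)"
    unfolding form_def by (intro sum.cong) (auto simp: unit_vec_def)
  ultimately show ?thesis by simp
qed

lemma form_unit_vec': "s \<in> V \<Longrightarrow> form f (unit_vec s) = pairing s f"
  using form_unit_vec form_sym by metis

lemma form_reflect: "s \<in> V \<Longrightarrow> form (reflect s f) (reflect s g) = form f g"
  unfolding reflect_eq form_lincomb form_lincomb' by (simp add: form_unit_vec form_unit_vec')

definition act :: "'a list \<Rightarrow> ('a \<Rightarrow> real) \<Rightarrow> 'a \<Rightarrow> real" where
  "act w = fold (\<lambda>s g. g \<circ> reflect s) w id"

lemma act_Nil [simp]: "act [] = id"
  by (simp add: act_def)

lemma act_snoc: "act (w @ [s]) = act w \<circ> reflect s"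
  by (simp add: act_def)

lemma act_append: "act (u @ v) = act u \<circ> act v"
proof (induction v rule: rev_induct)
  case (snoc s v)
  then show ?case using act_snoc[of "u @ v" s] act_snoc[of v s] by (simp add: comp_assoc)
qed auto

lemma act_Cons: "act (s # w) = reflect s \<circ> act w"
  using act_append[of "[s]" w] act_snoc[of "[]" s] by simp

text \<open>The image of the Coxeter group under the geometric representation.\<close>

definition weyl :: "(('a \<Rightarrow> real) \<Rightarrow> 'a \<Rightarrow> real) set" where
  "weyl = act ` lists V"

lemma weyl_id [simp]: "id \<in> weyl"
  unfolding weyl_def by (rule image_eqI[of _ _ "[]"]) auto

lemma weyl_reflect: "g \<in> weyl \<Longrightarrow> s \<in> V \<Longrightarrow> g \<circ> reflect s \<in> weyl"
  unfolding weyl_def by (auto simp flip: act_snoc intro!: imageI)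

lemma weyl_act: "g \<in> weyl \<Longrightarrow> w \<in> lists V \<Longrightarrow> g \<circ> act w \<in> weyl"
  by (induction w rule: rev_induct) (auto simp: act_snoc comp_assoc[symmetric] intro: weyl_reflect)

lemma act_weyl: "set w \<subseteq> V \<Longrightarrow> act w \<in> weyl"
  unfolding weyl_def by auto

lemma weyl_induct [consumes 1, case_names id reflect]:
  assumes "g \<in> weyl" "P id" "\<And>g s. g \<in> weyl \<Longrightarrow> P g \<Longrightarrow> s \<in> V \<Longrightarrow> P (g \<circ> reflect s)"
  shows "P g"
proof -
  obtain w where w: "w \<in> lists V" "g = act w" using assms(1) unfolding weyl_def by blast
  have "P (act w) \<and> act w \<in> weyl" using w(1)
    by (induction w rule: rev_induct) (auto simp: act_snoc assms intro: weyl_reflect)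
  then show ?thesis using w by simp
qed

lemma weyl_lincomb: "g \<in> weyl \<Longrightarrow> g (lincomb a f b h) = lincomb a (g f) b (g h)"
  by (induction arbitrary: f h rule: weyl_induct) (auto simp: reflect_lincomb)

lemma weyl_neg: "g \<in> weyl \<Longrightarrow> g (neg f) = neg (g f)"
  by (simp add: neg_lincomb weyl_lincomb)

lemma weyl_form: "g \<in> weyl \<Longrightarrow> form (g f) (g h) = form f h"
  by (induction arbitrary: f h rule: weyl_induct) (auto simp: form_reflect)

lemma weyl_inj: "g \<in> weyl \<Longrightarrow> inj g"
proof (induction rule: weyl_induct)
  case (reflect g s)
  have "inj (reflect s)" using reflect by (intro inj_on_inverseI[of _ "reflect s"]) simp
  then show ?case using reflect by (intro inj_compose) auto
qed auto

text \<open>A reflection \<open>reflect s\<close> alters only the coordinate \<open>s\<close>. This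
  is how letters outside \<open>X\<close> are detected.\<close>

lemma act_support:
  assumes "set w \<subseteq> X" "x \<notin> X"
  shows "act w f x = f x"
  using assms by (induction w) (auto simp: act_Cons, metis reflect_other)

subsection \<open>Dihedral subgroups\<close>

text \<open>If \<open>s\<close> and \<open>t\<close> are joined by an edge labelled \<open>m\<close>, the \<open>beta n s t\<close> with \<open>n < m\<close> are the positive
  roots of the dihedral group of \<open>s\<close> and \<open>t\<close>, ordered from the simple root of \<open>s\<close> to that of \<open>t\<close>.\<close>

definition beta :: "nat \<Rightarrow> 'a \<Rightarrow> 'a \<Rightarrow> 'a \<Rightarrow> real" where
  "beta n s t = lincomb (cheb (- bil s t) (Suc n)) (unit_vec s) (cheb (- bil s t) n) (unit_vec t)"

lemma beta_0 [simp]: "beta 0 s t = unit_vec s"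
  by (simp add: beta_def lincomb_def)

text \<open>In the coordinates of \<open>beta\<close> this is the Chebyshev recurrence.\<close>

lemma reflect_beta: "s \<in> V \<Longrightarrow> t \<in> V \<Longrightarrow> s \<noteq> t \<Longrightarrow> reflect s (beta n t s) = beta (Suc n) s t"
  unfolding beta_def reflect_lincomb reflect_unit_vec bil_sym[of t s]
  by (auto simp: reflect_eq lincomb_def neg_def algebra_simps)

text \<open>These are the roots met along an alternating word: each letter contributes its simple
  root, moved by the prefix before it.\<close>

lemma act_alt_unit_vec:
  assumes "s \<in> V" "t \<in> V" "s \<noteq> t"
  shows "act (alt n s t) (unit_vec (if even n then s else t)) = beta n s t"
  using assms
proof (induction n arbitrary: s t)
  case (Suc n)
  from Suc.IH[of t s] Suc.prems show ?case
    using reflect_beta[of s t n] by (auto simp: act_Cons)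
qed auto

lemma act_fix: "set w \<subseteq> X \<Longrightarrow> (\<And>s. s \<in> X \<Longrightarrow> pairing s f = 0) \<Longrightarrow> act w f = f"
  by (induction w) (auto simp: act_Cons reflect_def)

lemma bil_label: "label \<Gamma> {s, t} = Some m \<Longrightarrow> - bil s t = cos (pi / m)"
  using labelD(3) by (auto simp: bil_def)

lemma beta_swap:
  assumes "label \<Gamma> {s, t} = Some m" "n < m"
  shows "beta n t s = beta (m - Suc n) s t"
proof -
  note c = labelD(4)[OF assms(1)] bil_label[OF assms(1)]
  have "cheb (- bil s t) (m - Suc n) = cheb (- bil s t) (Suc n)"
    "cheb (- bil s t) (m - n) = cheb (- bil s t) n"
    using cheb_reflect[OF c] assms(2) by auto
  then show ?thesis using assms(2) by (auto simp: beta_def bil_sym[of t s] lincomb_def Suc_diff_Suc)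
qed

text \<open>Both words agree on the plane of the two simple roots and fix its orthogonal complement.
  The form is nondegenerate on the plane, so every vector splits accordingly.\<close>

lemma act_alt_braid:
  assumes lab: "label \<Gamma> {s, t} = Some m"
  shows "act (alt m s t) = act (alt m t s)"
proof
  fix f
  let ?c = "- bil s t"
  have st: "s \<in> V" "t \<in> V" "s \<noteq> t" "2 \<le> m" using labelD[OF lab] by auto
  note c = st(4) bil_label[OF lab]
  obtain n where n: "m = Suc n" using st(4) by (cases m) auto
  \<comment> \<open>The letter that would continue the word gives \<open>beta m a b\<close>, whose
    coefficients are \<open>cheb c (Suc m) = -1\<close> and \<open>cheb c m = 0\<close>.\<close>
  have next_letter: "act (alt m a b) (unit_vec (if even m then a else b)) = neg (unit_vec a)"
    if "a \<in> V" "b \<in> V" "a \<noteq> b" "- bil a b = ?c" for a b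
    using cheb_m[OF c] that by (simp add: act_alt_unit_vec beta_def lincomb_def neg_def)
  have last_letter: "act (alt m a b) (unit_vec (if even m then b else a)) = neg (unit_vec b)"
    if "a \<in> V" "b \<in> V" "a \<noteq> b" "- bil a b = ?c" for a b
  proof -
    let ?x = "if even n then a else b"
    have "act (alt m a b) (unit_vec ?x) = act (alt n a b) (reflect ?x (unit_vec ?x))"
      unfolding n alt_snoc act_snoc by simp
    also have "\<dots> = act (alt n a b) (neg (unit_vec ?x))"
      using that reflect_unit_vec[of ?x] by (auto split: if_splits)
    also have "\<dots> = neg (act (alt n a b) (unit_vec ?x))"
      using that set_alt[of n a b] by (intro weyl_neg act_weyl) auto
    also have "act (alt n a b) (unit_vec ?x) = beta n a b" using that by (intro act_alt_unit_vec)
    also have "beta n a b = unit_vec b"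
      using that cheb_m[OF c] by (simp add: beta_def n lincomb_def)
    finally show ?thesis by (cases "even n") (simp_all add: n)
  qed
  have eq: "act (alt m s t) (unit_vec x) = act (alt m t s) (unit_vec x)" if "x \<in> {s, t}" for x
    using that next_letter[of s t] next_letter[of t s] last_letter[of s t] last_letter[of t s] st
      bil_sym[of s t] by (auto split: if_splits)
  \<comment> \<open>The Gram determinant of the plane; \<open>a\<close> and \<open>b\<close> below
    come from Cramer's rule, and \<open>h\<close> is the orthogonal projection of \<open>f\<close>
    to the plane.\<close>
  have det: "1 - ?c * ?c \<noteq> 0"
    using cos_pi_div[OF c] by (smt (verit) mult_le_one mult_left_le)
  define D where "D = 1 - ?c * ?c"
  define a where "a = (pairing s f + ?c * pairing t f) / D"
  define b where "b = (pairing t f + ?c * pairing s f) / D"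
  define h where "h = lincomb a (unit_vec s) b (unit_vec t)"
  define g where "g = lincomb 1 f (-1) h"
  have D: "D * a = pairing s f + ?c * pairing t f" "D * b = pairing t f + ?c * pairing s f"
    using det by (simp_all add: a_def b_def D_def)
  have "D * (a - ?c * b) = D * a - ?c * (D * b)" "D * (b - ?c * a) = D * b - ?c * (D * a)"
    by (simp_all add: algebra_simps)
  then have "D * (a - ?c * b) = D * pairing s f" "D * (b - ?c * a) = D * pairing t f"
    unfolding D by (simp_all add: D_def algebra_simps)
  then have ab: "a - ?c * b = pairing s f" "b - ?c * a = pairing t f"
    using det by (simp_all add: D_def)
  have "pairing x g = 0" if "x \<in> {s, t}" for x
    using that ab st bil_sym[of t s] by (auto simp: g_def h_def pairing_lincomb algebra_simps)
  then have g: "act (alt m s t) g = g" "act (alt m t s) g = g"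
    using act_fix[OF set_alt] by (metis insert_commute)+
  have f: "f = lincomb 1 g 1 h" by (auto simp: g_def lincomb_def)
  have W: "act (alt m s t) \<in> weyl" "act (alt m t s) \<in> weyl"
    using st by (intro act_weyl set_alt_subset; simp)+
  show "act (alt m s t) f = act (alt m t s) f"
    unfolding f h_def weyl_lincomb[OF W(1)] weyl_lincomb[OF W(2)] g using eq by simp
qed

subsection \<open>Roots are positive or negative\<close>

definition len :: "(('a \<Rightarrow> real) \<Rightarrow> 'a \<Rightarrow> real) \<Rightarrow> nat" where
  "len g = (LEAST n. \<exists>w\<in>lists V. act w = g \<and> length w = n)"

lemma len_le: "w \<in> lists V \<Longrightarrow> len (act w) \<le> length w"
  unfolding len_def by (rule Least_le) blast

lemma len_attained:
  assumes "g \<in> weyl"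
  obtains w where "w \<in> lists V" "act w = g" "length w = len g"
proof -
  have "\<exists>n. \<exists>w\<in>lists V. act w = g \<and> length w = n" using assms unfolding weyl_def by blast
  then have "\<exists>w\<in>lists V. act w = g \<and> length w = len g" unfolding len_def by (rule LeastI_ex)
  then show ?thesis using that by blast
qed

lemma len_act:
  assumes "g \<in> weyl" "w \<in> lists V"
  shows "len (g \<circ> act w) \<le> len g + length w"
proof -
  obtain u where "u \<in> lists V" "act u = g" "length u = len g" using len_attained[OF assms(1)] .
  then show ?thesis using len_le[of "u @ w"] assms(2) by (auto simp: act_append)
qed

text \<open>Induction on length. With \<open>t\<close> the last letter of a reduced word of
  \<open>g\<close>, the longest possible alternating suffix in \<open>s\<close> and \<open>t\<close>
  is removed. The remaining \<open>v\<close> is shorter and maps both simple roots to nonnegative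
  vectors, and the suffix maps the root of \<open>s\<close> to a nonnegative combination of
  them.\<close>

lemma weyl_nonneg:
  assumes "g \<in> weyl" "s \<in> V" "len g \<le> len (g \<circ> reflect s)"
  shows "nonneg (g (unit_vec s))"
  using assms
proof (induction "len g" arbitrary: g s rule: less_induct)
  case less
  obtain w where w: "w \<in> lists V" "act w = g" "length w = len g" using len_attained[OF less.prems(1)] .
  show ?case
  proof (cases w rule: rev_cases)
    case Nil
    then show ?thesis using w by auto
  next
    case (snoc w' t)
    have t: "t \<in> V" "w' \<in> lists V" using w snoc by auto
    have gt: "g \<circ> reflect t = act w'" using t by (simp add: w(2)[symmetric] snoc act_snoc comp_assoc)
    then have "len (g \<circ> reflect t) < len g" using len_le[OF t(2)] w(3) snoc by simp
    with less.prems(3) have "s \<noteq> t" by auto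
    \<comment> \<open>\<open>R k\<close> says that \<open>g\<close> has a reduced expression ending
      in an alternating word of length \<open>k\<close> whose last letter is
      \<open>t\<close>.\<close>
    define R where "R k \<longleftrightarrow> (\<exists>v\<in>weyl. g = v \<circ> act (rev (alt k t s)) \<and> len v + k = len g)" for k
    have "len (act w') = length w'"
      using len_act[of "act w'" "[t]"] len_le[OF t(2)] t w snoc weyl_act[OF weyl_id t(2)]
      by (auto simp: act_append)
    then have "R 1" unfolding R_def using w snoc weyl_act[OF weyl_id t(2)] t
      by (intro bexI[of _ "act w'"]) (auto simp: act_append)
    moreover have "\<forall>k. R k \<longrightarrow> k < Suc (len g)" unfolding R_def by auto
    ultimately obtain k where k: "R k" "\<And>j. R j \<Longrightarrow> j \<le> k"
      using ex_has_greatest_nat[of R 1 "\<lambda>k. k" "Suc (len g)"] by auto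
    have "1 \<le> k" using k(2) \<open>R 1\<close> .
    then obtain k' where k': "k = Suc k'" by (cases k) auto
    obtain v where v: "v \<in> weyl" "g = v \<circ> act (rev (alt k t s))" "len v + k = len g"
      using k(1) unfolding R_def by blast
    let ?a = "if even k' then t else s" and ?b = "if even k' then s else t"
    have ab: "?a \<in> V" "?b \<in> V" using t less.prems by auto
    have altV: "rev (alt j t s) \<in> lists V" for j
      using set_alt_subset[OF t(1) less.prems(2), of j]
      by (simp only: lists_eq_set mem_Collect_eq set_rev)
    have rev_Suc: "rev (alt k t s) = ?a # rev (alt k' t s)" unfolding k' alt_snoc by simp
    \<comment> \<open>The letter \<open>?a\<close> begins the removed suffix, so a shorter
      \<open>v \<circ> reflect ?a\<close> would give a shorter expression of
      \<open>g\<close>.\<close>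
    have a: "len v \<le> len (v \<circ> reflect ?a)"
    proof (rule ccontr)
      assume "\<not> ?thesis"
      moreover have "g = (v \<circ> reflect ?a) \<circ> act (rev (alt k' t s))"
        unfolding v(2) rev_Suc act_Cons by (simp add: comp_assoc)
      then have "len g \<le> len (v \<circ> reflect ?a) + k'"
        using len_act[OF weyl_reflect[OF v(1) ab(1)] altV[of k']] by simp
      ultimately show False using v(3) k' by simp
    qed
    \<comment> \<open>Here a shorter \<open>v \<circ> reflect ?b\<close> would extend the
      alternating suffix, against the maximality of \<open>k\<close>.\<close>
    have b: "len v \<le> len (v \<circ> reflect ?b)"
    proof (rule ccontr)
      assume less_b: "\<not> ?thesis"
      have vb: "v = (v \<circ> reflect ?b) \<circ> act [?b]"
        using ab(2) by (auto simp: act_Cons fun_eq_iff)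
      have "len v \<le> len (v \<circ> reflect ?b) + 1"
        using len_act[OF weyl_reflect[OF v(1) ab(2)], of "[?b]"] vb ab by simp
      then have "len (v \<circ> reflect ?b) + Suc k = len g" using less_b v(3) by simp
      moreover have "alt (Suc k) t s = alt k t s @ [?b]"
        by (simp only: alt_snoc[of k t s]) (simp add: k' del: alt_word.simps)
      then have "rev (alt (Suc k) t s) = ?b # rev (alt k t s)" by (simp only: rev_append) simp
      then have "g = (v \<circ> reflect ?b) \<circ> act (rev (alt (Suc k) t s))"
        using v(2) ab(2) by (auto simp: act_Cons fun_eq_iff)
      ultimately have "R (Suc k)" unfolding R_def using weyl_reflect[OF v(1) ab(2)] by blast
      then show False using k(2) by fastforce
    qed
    have "len v < len g" using v(3) \<open>1 \<le> k\<close> by simp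
    then have pos: "nonneg (v (unit_vec ?a))" "nonneg (v (unit_vec ?b))"
      using less.hyps[OF _ v(1)] a b ab by blast+
    let ?c = "- bil s t"
    have coeffs: "0 \<le> cheb ?c k \<and> 0 \<le> cheb ?c (Suc k)"
    proof (cases "label \<Gamma> {s, t}")
      case None
      then have "?c = 1" using \<open>s \<noteq> t\<close> by (simp add: bil_def)
      then show ?thesis using cheb_one by simp
    next
      case (Some m)
      note c = labelD(4)[OF Some] bil_label[OF Some]
      \<comment> \<open>A suffix of length at least \<open>m\<close> ends in a full braid word,
        which can be rewritten to end in \<open>s\<close>; then \<open>g \<circ> reflect s\<close>
        would be shorter than \<open>g\<close>.\<close>
      have "k < m"
      proof (rule ccontr)
        assume "\<not> k < m"
        then obtain j where j: "k = m + j" using le_Suc_ex by (meson not_less)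
        obtain r where r: "alt k t s = alt m t s @ r" "length r = j" "set r \<subseteq> {t, s}"
          using alt_add[of m j t s] j by auto
        have rV: "rev r \<in> lists V" using r(3) t less.prems by auto
        obtain m' where m': "m = Suc m'" using c(1) by (cases m) auto
        have "act (rev (alt m t s)) = act (rev (alt m s t))"
          using act_alt_braid[OF Some] by (simp add: rev_alt)
        then have "g = v \<circ> act (rev r) \<circ> act (rev (alt m s t))"
          unfolding v(2) r(1) by (simp add: act_append comp_assoc)
        moreover have "rev (alt m s t) = rev (alt m' t s) @ [s]" by (simp add: m')
        ultimately have "g \<circ> reflect s = v \<circ> act (rev r @ rev (alt m' t s))"
          using less.prems(2) by (auto simp: act_append act_snoc fun_eq_iff act_Cons)
        then have "len (g \<circ> reflect s) \<le> len v + (j + m')"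
          using len_act[OF v(1), of "rev r @ rev (alt m' t s)"] rV altV[of m'] r(2) by simp
        then show False using less.prems(3) v(3) j m' by simp
      qed
      then show ?thesis using cheb_nonneg[OF c] by simp
    qed
    have parity: "even k \<longleftrightarrow> odd k'" by (simp add: k')
    have "act (rev (alt k t s)) (unit_vec s) = beta k ?a ?b"
      using act_alt_unit_vec[of s t k] act_alt_unit_vec[of t s k] t(1) less.prems(2) \<open>s \<noteq> t\<close>
        parity
      by (cases "even k") (simp_all add: rev_alt)
    then have "g (unit_vec s) = v (beta k ?a ?b)" using v(2) by simp
    also have "\<dots> = lincomb (cheb ?c (Suc k)) (v (unit_vec ?a)) (cheb ?c k) (v (unit_vec ?b))"
      unfolding beta_def weyl_lincomb[OF v(1)] using bil_sym[of s t] by auto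
    finally show ?thesis using pos coeffs by (simp add: nonneg_lincomb)
  qed
qed

text \<open>If \<open>g \<circ> reflect s\<close> is the shorter one, \<open>weyl_nonneg\<close>
  applies to it, and it maps the simple root of \<open>s\<close> to the negative of
  \<open>g (unit_vec s)\<close>.\<close>

lemma root_sign:
  assumes "g \<in> weyl" "s \<in> V"
  shows "nonneg (g (unit_vec s)) \<or> nonneg (neg (g (unit_vec s)))"
proof (cases "len g \<le> len (g \<circ> reflect s)")
  case True
  then show ?thesis using weyl_nonneg assms by blast
next
  case False
  have "g \<circ> reflect s \<circ> reflect s = g" using assms(2) by (auto simp: fun_eq_iff)
  then have "nonneg ((g \<circ> reflect s) (unit_vec s))"
    using weyl_nonneg[OF weyl_reflect[OF assms] assms(2)] False by simp
  then show ?thesis using assms by (simp add: reflect_unit_vec weyl_neg)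
qed

lemma weyl_inverse: "g \<in> weyl \<Longrightarrow> \<exists>h\<in>weyl. g \<circ> h = id \<and> h \<circ> g = id"
proof -
  assume "g \<in> weyl"
  then obtain w where w: "w \<in> lists V" "g = act w" unfolding weyl_def by blast
  have "act w \<circ> act (rev w) = id \<and> act (rev w) \<circ> act w = id" using w(1)
  proof (induction w)
    case (Cons s w)
    then have "w \<in> lists V" "s \<in> V" by simp_all
    with Cons.IH have IH: "act w \<circ> act (rev w) = id" "act (rev w) \<circ> act w = id" by blast+
    have "act (s # w) \<circ> act (rev (s # w)) = reflect s \<circ> (act w \<circ> act (rev w)) \<circ> reflect s"
      by (simp add: act_Cons act_snoc comp_assoc)
    moreover have "act (rev (s # w)) \<circ> act (s # w) = act (rev w) \<circ> (reflect s \<circ> reflect s) \<circ> act w"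
      by (simp add: act_Cons act_snoc comp_assoc)
    ultimately show ?case using \<open>s \<in> V\<close> by (simp only: IH reflect_comp_reflect comp_id)
  qed auto
  moreover have "act (rev w) \<in> weyl" using w(1) by (intro act_weyl) auto
  ultimately show ?thesis using w(2) by blast
qed

lemma reflect_neg: "reflect s (neg f) = neg (reflect s f)"
  by (simp add: neg_lincomb reflect_lincomb)

subsection \<open>Roots of a dihedral subgroup\<close>

text \<open>The negatives are included to make the set stable under \<open>reflect s\<close>, which
  negates the simple root of \<open>s\<close>.\<close>

definition dihedral_roots :: "nat \<Rightarrow> 'a \<Rightarrow> 'a \<Rightarrow> ('a \<Rightarrow> real) set" where
  "dihedral_roots m s t = {f. \<exists>n<m. f = beta n s t \<or> f = neg (beta n s t)}"

text \<open>The orthogonal reflection in a vector \<open>\<gamma>\<close> of norm one.\<close>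

definition root_reflect :: "('a \<Rightarrow> real) \<Rightarrow> ('a \<Rightarrow> real) \<Rightarrow> 'a \<Rightarrow> real" where
  "root_reflect \<gamma> f = lincomb 1 f (- 2 * form \<gamma> f) \<gamma>"

lemma root_reflect_unit_vec: "s \<in> V \<Longrightarrow> root_reflect (unit_vec s) = reflect s"
  by (auto simp: root_reflect_def reflect_eq form_unit_vec fun_eq_iff)

lemma root_reflect_conj:
  assumes "s \<in> V"
  shows "reflect s \<circ> root_reflect (reflect s \<gamma>) = root_reflect \<gamma> \<circ> reflect s"
proof
  fix f
  have "form (reflect s \<gamma>) f = form \<gamma> (reflect s f)"
    using form_reflect[OF assms, of \<gamma> "reflect s f"] assms by simp
  then show "(reflect s \<circ> root_reflect (reflect s \<gamma>)) f = (root_reflect \<gamma> \<circ> reflect s) f"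
    using assms by (simp add: root_reflect_def reflect_lincomb)
qed

context
  fixes m s t
  assumes lab: "label \<Gamma> {s, t} = Some m"
begin

lemma dihedral_roots_swap: "dihedral_roots m s t = dihedral_roots m t s"
proof -
  have "dihedral_roots m a b \<subseteq> dihedral_roots m b a" if ab: "label \<Gamma> {b, a} = Some m" for a b
  proof
    fix f assume "f \<in> dihedral_roots m a b"
    then obtain n where "n < m" "f = beta n a b \<or> f = neg (beta n a b)"
      unfolding dihedral_roots_def by blast
    then show "f \<in> dihedral_roots m b a"
      using beta_swap[OF ab] unfolding dihedral_roots_def by (auto intro!: exI[of _ "m - Suc n"])
  qed
  then show ?thesis using lab by (simp add: insert_commute subset_antisym)
qed

lemma dihedral_roots_reflect:
  assumes "f \<in> dihedral_roots m s t"
  shows "reflect s f \<in> dihedral_roots m s t"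
proof -
  note st = labelD[OF lab]
  have *: "reflect s (beta n s t) \<in> dihedral_roots m s t" if "n < m" for n
  proof (cases n)
    case 0
    then show ?thesis using st that
      by (auto simp: reflect_unit_vec dihedral_roots_def intro!: exI[of _ 0])
  next
    case (Suc n')
    have "reflect s (beta n s t) = beta n' t s"
      unfolding Suc using st by (simp flip: reflect_beta)
    then have "reflect s (beta n s t) \<in> dihedral_roots m t s"
      using that Suc by (auto simp: dihedral_roots_def intro!: exI[of _ n'])
    then show ?thesis by (simp add: dihedral_roots_swap)
  qed
  have neg_closed: "neg g \<in> dihedral_roots m s t" if "g \<in> dihedral_roots m s t" for g
    using that by (auto simp: dihedral_roots_def)
  obtain n where "n < m" "f = beta n s t \<or> f = neg (beta n s t)"
    using assms unfolding dihedral_roots_def by blast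
  then show ?thesis using * neg_closed reflect_neg by metis
qed

lemma beta_nonneg: "n < m \<Longrightarrow> nonneg (beta n s t)"
  unfolding beta_def
  using cheb_nonneg[OF labelD(4)[OF lab] bil_label[OF lab], of n]
    cheb_nonneg[OF labelD(4)[OF lab] bil_label[OF lab], of "Suc n"]
  by (intro nonneg_lincomb) auto

lemma beta_ne_unit_vec: "0 < n \<Longrightarrow> n < m \<Longrightarrow> beta n s t \<noteq> unit_vec s"
proof
  assume n: "0 < n" "n < m" "beta n s t = unit_vec s"
  have "beta n s t t = cheb (- bil s t) n"
    using labelD(3)[OF lab] by (simp add: beta_def lincomb_def unit_vec_def)
  then show False
    using n cheb_pos[OF labelD(4)[OF lab] bil_label[OF lab], of n] labelD(3)[OF lab]
    by (simp add: unit_vec_def)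
qed

text \<open>By d'Ocagne's identity a combination of the two roots, with coefficients
  \<open>?U j\<close> and \<open>- ?U i\<close>, is a positive multiple of the simple root of
  \<open>s\<close>. If \<open>0 < i\<close>, its image under \<open>d\<close> has coordinates of
  both signs, which no root has.\<close>

lemma two_simple_images:
  assumes "d \<in> weyl" "i < j" "j < m" "d (beta i s t) = unit_vec x" "d (beta j s t) = unit_vec y" "x \<noteq> y"
  shows "i = 0"
proof (rule ccontr)
  assume "i \<noteq> 0"
  let ?U = "cheb (- bil s t)"
  have pos: "0 < ?U n" if "0 < n" "n < m" for n
    using cheb_pos[OF labelD(4)[OF lab] bil_label[OF lab]] that .
  have "lincomb (?U j) (beta i s t) (- ?U i) (beta j s t) = lincomb (?U (j - i)) (unit_vec s) 0 (unit_vec s)"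
    using cheb_d_Ocagne[of "- bil s t" i "j - i"] assms(2)
    unfolding beta_def lincomb_lincomb by (simp add: lincomb_def algebra_simps)
  then have "d (lincomb (?U j) (beta i s t) (- ?U i) (beta j s t))
      = d (lincomb (?U (j - i)) (unit_vec s) 0 (unit_vec s))" by simp
  then have "lincomb (?U j) (unit_vec x) (- ?U i) (unit_vec y) = lincomb (?U (j - i)) (d (unit_vec s)) 0 (d (unit_vec s))"
    using assms(1,4,5) by (simp add: weyl_lincomb)
  then have *: "?U j * unit_vec x z - ?U i * unit_vec y z = ?U (j - i) * d (unit_vec s) z" for z
    by (simp add: lincomb_def fun_eq_iff)
  have eq: "?U j = ?U (j - i) * d (unit_vec s) x" "- ?U i = ?U (j - i) * d (unit_vec s) y"
    using *[of x] *[of y] assms(6) by (simp_all add: unit_vec_def)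
  have U: "0 < ?U j" "0 < ?U i" "0 < ?U (j - i)" using pos assms \<open>i \<noteq> 0\<close> by auto
  have "0 < d (unit_vec s) x" using U eq(1) by (simp add: zero_less_mult_iff)
  moreover have "?U (j - i) * d (unit_vec s) y < 0" using U eq(2) by simp
  then have "d (unit_vec s) y < 0" using U(3) by (simp add: mult_less_0_iff)
  ultimately show False
    using root_sign[OF assms(1) labelD(1)[OF lab]] unfolding nonneg_def neg_def
    by (meson neg_0_le_iff_le not_less)
qed

end

section \<open>Intersections of standard parabolic subgroups\<close>

text \<open>In a state \<open>(p, d)\<close> the word \<open>p\<close> represents an element of the subgroup generated by \<open>Y\<close>, and \<open>d\<close> is
  the minimal representative of a coset of the parabolic subgroup of \<open>Y\<close> in the Coxeter group;
  minimality is expressed by the positivity of the roots that \<open>d\<close> maps to simple roots of \<open>Y\<close>.\<close>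

definition min_rep :: "'a set \<Rightarrow> (('a \<Rightarrow> real) \<Rightarrow> 'a \<Rightarrow> real) \<Rightarrow> bool" where
  "min_rep Y d \<longleftrightarrow> d \<in> weyl \<and> (\<forall>y\<in>Y. \<forall>f. d f = unit_vec y \<longrightarrow> nonneg f)"

text \<open>If \<open>d\<close> maps the simple root of \<open>s\<close> to that of
  \<open>y\<close>, then \<open>d s = y d\<close> stays in the coset of \<open>d\<close>, and the
  letter passes through \<open>d\<close> as \<open>y\<close> with its sign. Otherwise
  \<open>d s\<close> represents a new coset.\<close>

definition retract_step :: "'a set \<Rightarrow> 'a \<times> bool \<Rightarrow> 'a word \<times> (('a \<Rightarrow> real) \<Rightarrow> 'a \<Rightarrow> real) \<Rightarrow>
    'a word \<times> (('a \<Rightarrow> real) \<Rightarrow> 'a \<Rightarrow> real)" where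
  "retract_step Y a = (\<lambda>(p, d).
     if \<exists>y\<in>Y. d (unit_vec (fst a)) = unit_vec y
     then (p @ [(THE y. d (unit_vec (fst a)) = unit_vec y, snd a)], d)
     else (p, d \<circ> reflect (fst a)))"

lemma retract_step_output:
  "y \<in> Y \<Longrightarrow> d (unit_vec s) = unit_vec y \<Longrightarrow> retract_step Y (s, b) (p, d) = (p @ [(y, b)], d)"
  by (auto simp: retract_step_def)

lemma retract_step_move:
  "(\<And>y. y \<in> Y \<Longrightarrow> d (unit_vec s) \<noteq> unit_vec y) \<Longrightarrow> retract_step Y (s, b) (p, d) = (p, d \<circ> reflect s)"
  by (auto simp: retract_step_def)

lemma min_rep_id: "min_rep Y id"
  by (simp add: min_rep_def)

text \<open>A negative \<open>f\<close> would have a positive reflection \<open>reflect s f\<close>.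
  The two differ only at the coordinate \<open>s\<close>, so \<open>f\<close> is a multiple of the
  simple root of \<open>s\<close>; having norm one, it is its negative, and then \<open>d\<close>
  maps the simple root of \<open>s\<close> to that of \<open>y\<close>.\<close>

lemma min_rep_reflect:
  assumes d: "min_rep Y d" and s: "s \<in> V" and Y: "Y \<subseteq> V"
    and no: "\<And>y. y \<in> Y \<Longrightarrow> d (unit_vec s) \<noteq> unit_vec y"
  shows "min_rep Y (d \<circ> reflect s)"
  unfolding min_rep_def
proof (intro conjI ballI allI impI)
  show W: "d \<circ> reflect s \<in> weyl" using d s weyl_reflect by (simp add: min_rep_def)
  fix y f assume y: "y \<in> Y" and f: "(d \<circ> reflect s) f = unit_vec y"
  have yV: "y \<in> V" using y Y by auto
  obtain h where h: "h \<in> weyl" "h \<circ> (d \<circ> reflect s) = id" using weyl_inverse[OF W] by blast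
  have fh: "f = h (unit_vec y)" using f h(2) by (metis comp_apply id_apply)
  show "nonneg f"
  proof (rule ccontr)
    assume "\<not> nonneg f"
    then have neg: "nonneg (neg f)" using root_sign[OF h(1) yV] fh by simp
    have pos: "nonneg (reflect s f)" using d y f by (auto simp: min_rep_def)
    have "f x = 0" if "x \<noteq> s" for x
      using neg pos reflect_other[OF that, of f] unfolding nonneg_def neg_def
      by (metis neg_0_le_iff_le order_antisym)
    then have f_eq: "f = lincomb (f s) (unit_vec s) 0 (unit_vec s)"
      by (auto simp: lincomb_def unit_vec_def fun_eq_iff)
    have "form f f = 1"
      unfolding fh weyl_form[OF h(1)] using yV by (simp add: form_unit_vec)
    moreover have "form f f = f s * f s"
      using f_eq s by (metis (no_types, lifting) add.right_neutral bil_refl form_lincomb form_lincomb'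
          form_unit_vec mult.right_neutral mult_zero_left pairing_unit_vec)
    ultimately have "(f s)\<^sup>2 = 1" by (simp add: power2_eq_square)
    moreover have "f s \<le> 0" using neg by (simp add: nonneg_def neg_def)
    ultimately have "f s = -1" by (simp add: power2_eq_1_iff)
    then have "f = neg (unit_vec s)" using f_eq by (simp add: lincomb_def neg_def)
    then have "reflect s f = unit_vec s"
      by (simp add: reflect_neg reflect_unit_vec s)
    then show False using f no[OF y] by simp
  qed
qed

text \<open>At letter number \<open>n\<close>, counted from \<open>0\<close>, the state is
  \<open>d\<close> composed with the prefix, so the test for an output concerns
  \<open>d (beta n s t)\<close>.\<close>

lemma retract_alt_move:
  assumes "s \<in> V" "t \<in> V" "s \<noteq> t"
    and "\<And>n y. n < k \<Longrightarrow> y \<in> Y \<Longrightarrow> d (beta n s t) \<noteq> unit_vec y"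
  shows "fold (retract_step Y) (alt_word k s t) (p, d) = (p, d \<circ> act (alt k s t))"
  using assms
proof (induction k arbitrary: s t d)
  case (Suc k)
  have "d (unit_vec s) \<noteq> unit_vec y" if "y \<in> Y" for y
    using Suc.prems(4)[of 0 y] that by simp
  moreover have "fold (retract_step Y) (alt_word k t s) (p, d \<circ> reflect s)
      = (p, d \<circ> reflect s \<circ> act (alt k t s))"
  proof (rule Suc.IH)
    show "(d \<circ> reflect s) (beta n t s) \<noteq> unit_vec y" if "n < k" "y \<in> Y" for n y
      using Suc.prems(4)[of "Suc n" y] that Suc.prems by (simp add: reflect_beta)
  qed (use Suc.prems in auto)
  ultimately show ?case by (simp add: retract_step_move act_Cons comp_def)
qed auto

text \<open>The letter number \<open>n\<close> is output instead of moving \<open>d\<close>.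
  Deleting it from the word amounts to multiplying by the reflection in \<open>beta n s t\<close>.
  Uniqueness is required over all dihedral roots because the induction replaces \<open>d\<close> by
  \<open>d \<circ> reflect s\<close>.\<close>

lemma retract_alt_one_output:
  assumes "label \<Gamma> {s, t} = Some m" "x \<in> Y" "d (beta n s t) = unit_vec x" "n < k" "k \<le> m"
    and "\<And>f y. f \<in> dihedral_roots m s t \<Longrightarrow> y \<in> Y \<Longrightarrow> d f = unit_vec y \<Longrightarrow> f = beta n s t"
  shows "fold (retract_step Y) (alt_word k s t) (p, d)
    = (p @ [(x, True)], d \<circ> root_reflect (beta n s t) \<circ> act (alt k s t))"
  using assms
proof (induction k arbitrary: s t d n)
  case (Suc k)
  note st = labelD[OF Suc.prems(1)]
  have lab': "label \<Gamma> {t, s} = Some m" using Suc.prems(1) by (simp add: insert_commute)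
  show ?case
  proof (cases n)
    case 0
    then have out: "d (unit_vec s) = unit_vec x" using Suc.prems(3) by simp
    have "fold (retract_step Y) (alt_word k t s) (p @ [(x, True)], d)
        = (p @ [(x, True)], d \<circ> act (alt k t s))"
    proof (rule retract_alt_move)
      fix j y assume j: "j < k" "y \<in> Y"
      \<comment> \<open>After the output the tests run through the roots from the end of
        \<open>t\<close>. As \<open>Suc k \<le> m\<close>, the index \<open>m - Suc j\<close> is
        positive, so the root of \<open>s\<close> is not met again.\<close>
      show "d (beta j t s) \<noteq> unit_vec y"
      proof
        assume "d (beta j t s) = unit_vec y"
        moreover have eq: "beta j t s = beta (m - Suc j) s t"
          using beta_swap[OF Suc.prems(1)] j Suc.prems by simp
        then have "beta j t s \<in> dihedral_roots m s t"
          using j Suc.prems by (auto simp: dihedral_roots_def intro!: exI[of _ "m - Suc j"])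
        ultimately have "beta j t s = beta n s t" using Suc.prems(6) j by blast
        then show False
          using eq beta_ne_unit_vec[OF Suc.prems(1), of "m - Suc j"] j Suc.prems(5) 0 by simp
      qed
    qed (use st in auto)
    moreover have "retract_step Y (s, True) (p, d) = (p @ [(x, True)], d)"
      by (rule retract_step_output[of x Y d s True p, OF Suc.prems(2) out])
    moreover have "reflect s \<circ> act (alt (Suc k) s t) = act (alt k t s)"
      using st by (simp add: act_Cons comp_assoc[symmetric])
    then have "d \<circ> root_reflect (beta n s t) \<circ> act (alt (Suc k) s t) = d \<circ> act (alt k t s)"
      using st 0 by (simp add: root_reflect_unit_vec comp_assoc del: alt_word.simps)
    moreover have "fold (retract_step Y) (alt_word (Suc k) s t) (p, d)
        = fold (retract_step Y) (alt_word k t s) (retract_step Y (s, True) (p, d))"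
      by simp
    ultimately show ?thesis by (simp only:)
  next
    case (Suc n')
    have \<gamma>: "reflect s (beta n s t) = beta n' t s"
      unfolding Suc using st by (simp flip: reflect_beta)
    have ne: "d (unit_vec s) \<noteq> unit_vec y" if "y \<in> Y" for y
    proof
      assume "d (unit_vec s) = unit_vec y"
      moreover have "unit_vec s \<in> dihedral_roots m s t"
        using st by (auto simp: dihedral_roots_def intro!: exI[of _ 0])
      ultimately have "unit_vec s = beta n s t" using Suc.prems(6) that by blast
      then show False using beta_ne_unit_vec[OF Suc.prems(1), of n] Suc Suc.prems by simp
    qed
    have "fold (retract_step Y) (alt_word k t s) (p, d \<circ> reflect s)
      = (p @ [(x, True)], d \<circ> reflect s \<circ> root_reflect (beta n' t s) \<circ> act (alt k t s))"
    proof (rule Suc.IH[OF lab' Suc.prems(2)])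
      show "(d \<circ> reflect s) (beta n' t s) = unit_vec x"
        using Suc.prems(3) st by (simp flip: \<gamma>)
      fix f y assume f: "f \<in> dihedral_roots m t s" "y \<in> Y" "(d \<circ> reflect s) f = unit_vec y"
      have "reflect s f \<in> dihedral_roots m s t"
        using f(1) dihedral_roots_reflect[OF Suc.prems(1)] dihedral_roots_swap[OF Suc.prems(1)] by simp
      then have "reflect s f = beta n s t" using Suc.prems(6) f by simp
      then show "f = beta n' t s" using \<gamma> reflect_reflect[OF st(1), of f] by simp
    qed (use Suc Suc.prems in auto)
    moreover have "d \<circ> reflect s \<circ> root_reflect (beta n' t s) \<circ> act (alt k t s)
        = d \<circ> root_reflect (beta n s t) \<circ> act (alt (Suc k) s t)"
      using arg_cong[OF root_reflect_conj[OF st(1), of "beta n s t"], of "\<lambda>f. d \<circ> f \<circ> act (alt k t s)"]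
      by (simp add: \<gamma> comp_assoc act_Cons)
    moreover have "fold (retract_step Y) (alt_word (Suc k) s t) (p, d)
        = fold (retract_step Y) (alt_word k t s) (retract_step Y (s, True) (p, d))"
      by simp
    moreover have "retract_step Y (s, True) (p, d) = (p, d \<circ> reflect s)"
      by (rule retract_step_move) (rule ne)
    ultimately show ?thesis by (simp only:)
  qed
qed auto

lemma retract_alt_both_outputs:
  assumes "x \<in> Y" "y \<in> Y" "d (unit_vec s) = unit_vec x" "d (unit_vec t) = unit_vec y"
  shows "fold (retract_step Y) (alt_word k s t) (p, d) = (p @ alt_word k x y, d)"
  using assms
  by (induction k arbitrary: s t x y p) (auto simp: retract_step_output)

text \<open>Minimality of \<open>d\<close> is built in, so that it is available on the diagonal as
  an invariant.\<close>

definition retract_rel :: "'a set \<Rightarrow> 'a word \<times> (('a \<Rightarrow> real) \<Rightarrow> 'a \<Rightarrow> real) \<Rightarrow>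
    'a word \<times> (('a \<Rightarrow> real) \<Rightarrow> 'a \<Rightarrow> real) \<Rightarrow> bool" where
  "retract_rel Y = (\<lambda>(p, d) (q, e). p \<simeq> q \<and> d = e \<and> min_rep Y d)"

lemma retract_rel_cong:
  assumes "s \<in> V" "Y \<subseteq> V" "retract_rel Y P Q"
  shows "retract_rel Y (retract_step Y (s, b) P) (retract_step Y (s, b) Q)"
proof -
  obtain p q d where *: "P = (p, d)" "Q = (q, d)" "p \<simeq> q" "min_rep Y d"
    using assms(3) by (auto simp: retract_rel_def)
  show ?thesis
  proof (cases "\<exists>y\<in>Y. d (unit_vec s) = unit_vec y")
    case True
    then obtain y where y: "y \<in> Y" "d (unit_vec s) = unit_vec y" by blast
    have "p @ [(y, b)] \<simeq> q @ [(y, b)]" using * y assms by (intro eq_append eq_refl) auto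
    then show ?thesis using * y by (simp add: retract_step_output retract_rel_def)
  next
    case False
    then show ?thesis using * assms min_rep_reflect[of Y d s]
      by (simp add: retract_step_move retract_rel_def)
  qed
qed

lemma retract_rel_cancel:
  assumes "s \<in> V" "Y \<subseteq> V" "retract_rel Y P P"
  shows "retract_rel Y (retract_step Y (s, \<not> b) (retract_step Y (s, b) P)) P"
proof -
  obtain p d where *: "P = (p, d)" "p \<simeq> p" "min_rep Y d"
    using assms(3) by (auto simp: retract_rel_def)
  show ?thesis
  proof (cases "\<exists>y\<in>Y. d (unit_vec s) = unit_vec y")
    case True
    then obtain y where y: "y \<in> Y" "d (unit_vec s) = unit_vec y" by blast
    have "p @ [(y, b), (y, \<not> b)] @ [] \<simeq> p @ []"
      using y assms eqD[OF *(2)] by (intro word_equiv.cancel) auto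
    then show ?thesis using * y by (simp add: retract_step_output retract_rel_def)
  next
    case False
    \<comment> \<open>Otherwise \<open>d\<close> would map the negative of a simple root to a simple
      root of \<open>Y\<close>, against minimality. So the second letter moves back.\<close>
    have "(d \<circ> reflect s) (unit_vec s) \<noteq> unit_vec y" if "y \<in> Y" for y
      using *(3) that not_nonneg_neg_unit_vec[of s] assms(1)
      by (auto simp: min_rep_def reflect_unit_vec)
    then show ?thesis using * False assms(1)
      by (simp add: retract_step_move retract_rel_def comp_assoc)
  qed
qed

text \<open>If no positive dihedral root goes to a simple root of \<open>Y\<close>, both sides only
  move. If exactly one does, both sides output its image and skip the same reflection. If two do,
  they are the simple roots of \<open>s\<close> and \<open>t\<close>, and the output is a braid
  relation with the same label.\<close>

lemma retract_rel_braid: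
  assumes lab: "label \<Gamma> {s, t} = Some m" and Y: "Y \<subseteq> V" and P: "retract_rel Y P P"
  shows "retract_rel Y (fold (retract_step Y) (alt_word m s t) P)
    (fold (retract_step Y) (alt_word m t s) P)"
proof -
  obtain p d where P_eq: "P = (p, d)" and p: "p \<in> words V" "p \<simeq> p" and d: "min_rep Y d"
    using P eqD by (auto simp: retract_rel_def)
  have dW: "d \<in> weyl" using d by (simp add: min_rep_def)
  note st = labelD[OF lab]
  have lab': "label \<Gamma> {t, s} = Some m" using lab by (simp add: insert_commute)
  have fold_rel: "retract_rel Y (fold (retract_step Y) w P) (fold (retract_step Y) w P)"
    if "w \<in> words V" for w
    using that P
  proof (induction w arbitrary: P)
    case (Cons a w)
    then show ?case using retract_rel_cong[OF _ Y, of "fst a" P P "snd a"] by simp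
  qed auto
  have self: "retract_rel Y (fold (retract_step Y) (alt_word m s t) P)
      (fold (retract_step Y) (alt_word m s t) P)"
    using st by (intro fold_rel alt_word_words) auto
  show ?thesis
  proof (cases "\<exists>n<m. \<exists>y\<in>Y. d (beta n s t) = unit_vec y")
    case False
    have "fold (retract_step Y) (alt_word m s t) (p, d) = (p, d \<circ> act (alt m s t))"
      using False st by (intro retract_alt_move) auto
    moreover have "d (beta n t s) \<noteq> unit_vec y" if "n < m" "y \<in> Y" for n y
      using False beta_swap[OF lab that(1)] that by auto
    then have "fold (retract_step Y) (alt_word m t s) (p, d) = (p, d \<circ> act (alt m t s))"
      using st by (intro retract_alt_move) auto
    ultimately show ?thesis using self act_alt_braid[OF lab] P_eq by simp
  next
    case True
    then obtain n x where n: "n < m" "x \<in> Y" "d (beta n s t) = unit_vec x" by blast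
    have n': "beta (m - Suc n) t s = beta n s t" using beta_swap[OF lab', of n] n by simp
    show ?thesis
    proof (cases "\<forall>f\<in>dihedral_roots m s t. \<forall>y\<in>Y. d f = unit_vec y \<longrightarrow> f = beta n s t")
      case True
      have "fold (retract_step Y) (alt_word m s t) (p, d)
          = (p @ [(x, True)], d \<circ> root_reflect (beta n s t) \<circ> act (alt m s t))"
        using True n by (intro retract_alt_one_output[OF lab]) auto
      moreover have "fold (retract_step Y) (alt_word m t s) (p, d)
          = (p @ [(x, True)], d \<circ> root_reflect (beta (m - Suc n) t s) \<circ> act (alt m t s))"
        using True n n' by (intro retract_alt_one_output[OF lab'])
          (auto simp: dihedral_roots_swap[OF lab'])
      ultimately show ?thesis using self act_alt_braid[OF lab] P_eq n' by simp
    next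
      case False
      then obtain f y where f: "f \<in> dihedral_roots m s t" "y \<in> Y" "d f = unit_vec y" "f \<noteq> beta n s t"
        by blast
      obtain j where j: "j < m" "f = beta j s t \<or> f = neg (beta j s t)"
        using f(1) unfolding dihedral_roots_def by blast
      \<comment> \<open>Minimality makes \<open>f\<close> nonnegative, as \<open>beta j s t\<close>
        is; so \<open>f\<close> would vanish, but its image is a unit vector.\<close>
      have "f \<noteq> neg (beta j s t)"
      proof
        assume fneg: "f = neg (beta j s t)"
        have "nonneg f" using d f by (simp add: min_rep_def)
        then have "f x = 0" for x
          using beta_nonneg[OF lab j(1)] unfolding fneg nonneg_def neg_def
          by (metis neg_0_le_iff_le neg_equal_0_iff_equal order_antisym)
        then have "f = lincomb 0 f 0 f" by (auto simp: lincomb_def)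
        then have "unit_vec y = lincomb 0 (d f) 0 (d f)" using f(3) weyl_lincomb[OF dW] by metis
        then have "unit_vec y y = (0::real)" by (simp add: lincomb_def)
        then show False by (simp add: unit_vec_def)
      qed
      then have fj: "f = beta j s t" using j by blast
      have xy: "x \<noteq> y"
        using f n injD[OF weyl_inj[OF dW], of f "beta n s t"] by auto
      \<comment> \<open>\<open>two_simple_images\<close> is applied from both ends: the lower root
        is that of \<open>s\<close>, and in the reversed order the upper one is that of
        \<open>t\<close>.\<close>
      have *: "d (unit_vec s) = unit_vec x1 \<and> d (unit_vec t) = unit_vec y1"
        if "i1 < j1" "j1 < m" "d (beta i1 s t) = unit_vec x1" "d (beta j1 s t) = unit_vec y1" "x1 \<noteq> y1"
        for i1 j1 x1 y1
      proof -
        have "i1 = 0" using two_simple_images[OF lab dW that] .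
        moreover have swap: "beta j1 s t = beta (m - Suc j1) t s" "beta i1 s t = beta (m - Suc i1) t s"
          using beta_swap[OF lab', of j1] beta_swap[OF lab', of i1] that(1,2) by linarith+
        have "m - Suc j1 = 0"
        proof (rule two_simple_images[OF lab' dW])
          show "m - Suc j1 < m - Suc i1" "m - Suc i1 < m" using that(1,2) by linarith+
          show "d (beta (m - Suc j1) t s) = unit_vec y1" using that(4) by (simp only: swap)
          show "d (beta (m - Suc i1) t s) = unit_vec x1" using that(3) by (simp only: swap)
        qed (use that in simp)
        then have "beta j1 s t = unit_vec t" by (simp add: swap)
        ultimately show ?thesis using that by simp
      qed
      obtain x' y' where x'y': "x' \<in> Y" "y' \<in> Y" "x' \<noteq> y'"
        "d (unit_vec s) = unit_vec x'" "d (unit_vec t) = unit_vec y'"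
      proof (cases "n < j")
        case True
        then show thesis using *[OF True j(1) n(3)] f fj xy n that by blast
      next
        case False
        then have "j < n" using f(4) fj by (cases "j = n") auto
        then show thesis using *[OF _ n(1), of j y x] f fj xy n that by blast
      qed
      have V: "x' \<in> V" "y' \<in> V" using x'y' Y by auto
      have "bil x' y' = form (d (unit_vec s)) (d (unit_vec t))"
        using V x'y' by (simp add: form_unit_vec)
      also have "\<dots> = bil s t" using st by (simp add: weyl_form[OF dW] form_unit_vec)
      finally have "- bil x' y' = cos (pi / m)" using bil_label[OF lab] by simp
      \<comment> \<open>This rules out a missing edge between \<open>x'\<close> and
        \<open>y'\<close>, at which the form is \<open>-1\<close>.\<close>
      moreover have "cos (pi / m) \<noteq> 1"
        using cos_pi_div(2)[OF st(4) HOL.refl] by simp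
      ultimately obtain k where k: "label \<Gamma> {x', y'} = Some k" "cos (pi / m) = cos (pi / k)"
        using x'y'(3) by (auto simp: bil_def split: option.splits)
      have "m = k" using cos_pi_div_inj[OF k(2) st(4) labelD(4)[OF k(1)]] .
      then have "p @ alt_word m x' y' \<simeq> p @ alt_word m y' x'"
        using p braid_eq k(1) by (intro eq_append) auto
      then show ?thesis
        using x'y' d by (simp add: P_eq retract_alt_both_outputs retract_rel_def)
    qed
  qed
qed

lemma retract_rel_eq:
  assumes "Y \<subseteq> V" "w \<simeq> w'"
  shows "retract_rel Y (fold (retract_step Y) w ([], id)) (fold (retract_step Y) w' ([], id))"
proof (rule fold_word_equiv[OF _ _ _ _ _ assms(2)])
  show "retract_rel Y q p" if "retract_rel Y p q" for p q
    using that by (auto simp: retract_rel_def intro: eq_sym)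
  show "retract_rel Y p r" if "retract_rel Y p q" "retract_rel Y q r" for p q r
    using that by (auto simp: retract_rel_def intro: eq_trans)
  show "retract_rel Y (retract_step Y (x, \<not> b) (retract_step Y (x, b) P)) P"
    if "x \<in> V" "retract_rel Y P P" for x b P
    using retract_rel_cancel assms(1) that by blast
  show "retract_rel Y ([], id) ([], id)"
    by (simp add: retract_rel_def min_rep_id eq_refl)
next
  fix a :: "'a \<times> bool" and p q
  assume "fst a \<in> V" "retract_rel Y p q"
  then show "retract_rel Y (retract_step Y a p) (retract_step Y a q)"
    using retract_rel_cong[of "fst a" Y p q "snd a"] assms(1) by simp
next
  fix l r P assume "(l, r) \<in> artin_relations \<Gamma>" and P: "retract_rel Y P P"
  then obtain k s t where lab: "label \<Gamma> {s, t} = Some k" "l = alt_word k s t" "r = alt_word k t s"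
    unfolding artin_relations_def by blast
  show "retract_rel Y (fold (retract_step Y) l P) (fold (retract_step Y) r P)"
    unfolding lab(2,3) by (rule retract_rel_braid[OF lab(1) assms(1) P])
qed

lemma retract_generated:
  assumes "w \<in> words Y"
  shows "fold (retract_step Y) w (p, id) = (p @ w, id)"
  using assms
proof (induction w arbitrary: p)
  case (Cons a w)
  have "retract_step Y a (p, id) = (p @ [a], id)"
    using retract_step_output[of "fst a" Y id "fst a" "snd a" p] Cons.prems by simp
  moreover have "fold (retract_step Y) w (p @ [a], id) = ((p @ [a]) @ w, id)"
    by (rule Cons.IH) (use Cons.prems in simp)
  ultimately show ?case by (simp only: fold_simps append.assoc append.simps)
qed auto

lemma in_gen_Int:
  assumes "X \<subseteq> V" "Y \<subseteq> V" "in_gen X z" "in_gen Y z"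
  shows "in_gen (X \<inter> Y) z"
proof -
  obtain a b where a: "a \<in> words X" "z \<simeq> a" and b: "b \<in> words Y" "z \<simeq> b"
    using assms(3,4) unfolding in_gen_def by blast
  \<comment> \<open>The invariant: \<open>d\<close> is a product of reflections from
    \<open>X\<close> and so preserves coordinates outside \<open>X\<close>. An output
    \<open>y\<close> outside \<open>X\<close> would have to equal the letter \<open>s\<close>, which
    lies in \<open>X\<close>.\<close>
  have step: "fst P \<in> words (X \<inter> Y) \<and> (\<exists>w. set w \<subseteq> X \<and> snd P = act w) \<Longrightarrow> w \<in> words X \<Longrightarrow>
      fst (fold (retract_step Y) w P) \<in> words (X \<inter> Y)" for w P
  proof (induction w arbitrary: P)
    case (Cons c w)
    obtain s b where c: "c = (s, b)" by (cases c)
    obtain p u where P: "P = (p, act u)" "p \<in> words (X \<inter> Y)" "set u \<subseteq> X"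
      using Cons.prems(1) by (cases P) auto
    have s: "s \<in> X" using Cons.prems(2) c by simp
    have "fst (retract_step Y c P) \<in> words (X \<inter> Y) \<and> (\<exists>w. set w \<subseteq> X \<and> snd (retract_step Y c P) = act w)"
    proof (cases "\<exists>y\<in>Y. act u (unit_vec s) = unit_vec y")
      case True
      then obtain y where y: "y \<in> Y" "act u (unit_vec s) = unit_vec y" by blast
      have "y \<in> X"
      proof (rule ccontr)
        assume "y \<notin> X"
        then have "act u (unit_vec s) y = unit_vec s y" using act_support P(3) by blast
        then have "unit_vec y y = unit_vec s y" using y(2) by simp
        then have "y = s" by (auto simp: unit_vec_def split: if_splits)
        then show False using s \<open>y \<notin> X\<close> by simp
      qed
      then show ?thesis using y P c by (auto simp: retract_step_output)
    next
      case False
      then show ?thesis using P s c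
        by (auto simp: retract_step_move act_snoc[symmetric] intro!: exI[of _ "u @ [s]"])
    qed
    then show ?case using Cons by simp
  qed auto
  have "retract_rel Y (fold (retract_step Y) a ([], id)) (fold (retract_step Y) b ([], id))"
    using a b assms(2) by (intro retract_rel_eq) (auto intro: eq_sym eq_trans)
  then have "fst (fold (retract_step Y) a ([], id)) \<simeq> b"
    by (auto simp: retract_rel_def retract_generated[OF b(1)] split: prod.splits)
  moreover have "fst (fold (retract_step Y) a ([], id)) \<in> words (X \<inter> Y)"
    using a(1) by (intro step) (auto intro!: exI[of _ "[]"])
  ultimately show ?thesis unfolding in_gen_def using b(2) eq_sym eq_trans by blast
qed

text \<open>Under the retraction onto \<open>{t}\<close>, the letter \<open>s\<close> moves the
  state to \<open>reflect s\<close>. From there the letters of \<open>z\<close> only switch between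
  \<open>reflect s\<close> and \<open>reflect s \<circ> reflect t\<close>, because
  \<open>m \<noteq> 2\<close> gives the image of the root of \<open>t\<close> a nonzero coordinate
  at \<open>s\<close>. So \<open>s z\<close> retracts to the empty word, whereas \<open>z s\<close>
  retracts to \<open>z\<close>.\<close>

lemma commuting_power_trivial:
  assumes lab: "label \<Gamma> {s, t} = Some m" "m \<noteq> 2"
    and z: "z \<in> words {t}" "[(s, True)] @ z \<simeq> z @ [(s, True)]"
  shows "z \<simeq> []"
proof -
  note st = labelD[OF lab(1)]
  have bil: "bil s t \<noteq> 0"
    using bil_label[OF lab(1)] cos_pi_div_inj[of m 2] lab(2) st(4) by auto
  have 0: "reflect s (unit_vec t) s = - 2 * bil s t"
    "reflect s (reflect t (unit_vec t)) = neg (reflect s (unit_vec t))"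
    using st by (simp_all add: reflect_unit_vec reflect_neg) (simp add: reflect_def, simp add: unit_vec_def)
  have 1: "reflect s (unit_vec t) s \<noteq> 0" "reflect s (reflect t (unit_vec t)) s \<noteq> 0"
    using bil st unfolding 0(2) by (simp_all add: neg_def 0(1))
  have ne: "d (unit_vec t) \<noteq> unit_vec t" if "d = reflect s \<or> d = reflect s \<circ> reflect t" for d
    using that 1 st(3) by (auto simp: unit_vec_def fun_eq_iff)
  have "fst (fold (retract_step {t}) w ([], d)) = []"
    if "w \<in> words {t}" "d = reflect s \<or> d = reflect s \<circ> reflect t" for w d
    using that
  proof (induction w arbitrary: d)
    case (Cons a w)
    have step: "retract_step {t} a ([], d) = ([], d \<circ> reflect t)"
      using retract_step_move[of "{t}" d "fst a" "snd a" "[]"] ne[OF Cons.prems(2)] Cons.prems(1)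
      by auto
    have "d \<circ> reflect t = reflect s \<or> d \<circ> reflect t = reflect s \<circ> reflect t"
      using Cons.prems st by (auto simp: comp_assoc)
    moreover have "w \<in> words {t}" using Cons.prems by simp
    ultimately have "fst (fold (retract_step {t}) w ([], d \<circ> reflect t)) = []"
      using Cons.IH by blast
    with step show ?case by (simp only: fold_simps)
  qed auto
  moreover have step: "retract_step {t} (s, True) (p, id) = (p, reflect s)" for p
    using st(3) retract_step_move[of "{t}" id s True p] by (simp only: id_comp) simp
  ultimately have 2: "fst (fold (retract_step {t}) ([(s, True)] @ z) ([], id)) = []"
    using z(1) by simp
  have 3: "fst (fold (retract_step {t}) (z @ [(s, True)]) ([], id)) = z"
    using retract_generated[OF z(1)] step by simp
  have "retract_rel {t} (fold (retract_step {t}) ([(s, True)] @ z) ([], id))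
      (fold (retract_step {t}) (z @ [(s, True)]) ([], id))"
    using z(2) st by (intro retract_rel_eq) auto
  then have "[] \<simeq> z" using 2 3 by (auto simp: retract_rel_def split: prod.splits)
  then show ?thesis by (rule eq_sym)
qed

end

lemma word_equiv_mono: "word_equiv X R u v \<Longrightarrow> R \<subseteq> R' \<Longrightarrow> word_equiv X R' u v"
  by (induction rule: word_equiv.induct) (blast intro: word_equiv.intros)+

lemma word_class_eq_iff:
  "u \<in> words X \<Longrightarrow> v \<in> words X \<Longrightarrow>
    word_rel X R `` {u} = word_rel X R `` {v} \<longleftrightarrow> word_equiv X R u v"
  using eq_equiv_class_iff[OF equiv_word_rel, of u X v R] by (simp add: word_rel_def)

lemma carrier_presented_group: "carrier (presented_group X R) = (\<lambda>w. word_rel X R `` {w}) ` words X"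
  by (auto simp: presented_group_def quotient_def)

context artin
begin

section \<open>Infinite Coxeter groups\<close>

abbreviation coxeter_relations where
  "coxeter_relations \<equiv> artin_relations \<Gamma> \<union> {([(s, True), (s, True)], []) | s. s \<in> V}"

lemma act_coxeter:
  assumes "word_equiv V coxeter_relations w w'"
  shows "act (map fst w) = act (map fst w')"
proof -
  define st :: "'a \<times> bool \<Rightarrow> (('a \<Rightarrow> real) \<Rightarrow> 'a \<Rightarrow> real) \<Rightarrow> ('a \<Rightarrow> real) \<Rightarrow> 'a \<Rightarrow> real"
    where "st a g = g \<circ> reflect (fst a)" for a g
  have fold_st: "fold st w g = g \<circ> act (map fst w)" for w g
    by (induction w arbitrary: g) (auto simp: st_def act_Cons comp_assoc)
  have "fold st w id = fold st w' id"
  proof (rule fold_word_equiv[where Rel = "(=)", OF _ _ _ _ _ assms])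
    show "st (x, \<not> b) (st (x, b) p) = p" if "x \<in> V" for x b p
      using that by (simp add: st_def comp_assoc)
  next
    fix l r p assume "(l, r) \<in> coxeter_relations"
    then consider k s t where "label \<Gamma> {s, t} = Some k" "l = alt_word k s t" "r = alt_word k t s"
      | s where "s \<in> V" "l = [(s, True), (s, True)]" "r = []"
      unfolding artin_relations_def by blast
    then show "fold st l p = fold st r p"
    proof cases
      case 1
      then show ?thesis using act_alt_braid[OF 1(1)] by (simp add: fold_st)
    next
      case 2
      then show ?thesis by (simp add: st_def comp_assoc)
    qed
  qed auto
  then show ?thesis by (simp only: fold_st id_comp)
qed

lemma act_artin: "w \<simeq> w' \<Longrightarrow> act (map fst w) = act (map fst w')"
  by (rule act_coxeter) (erule word_equiv_mono, blast)

text \<open>Words over \<open>X\<close> preserve the coordinate \<open>u\<close> of every vector,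
  but \<open>u\<close> negates its own simple root.\<close>

lemma vertex_not_in_gen:
  assumes "u \<in> V" "u \<notin> X"
  shows "\<not> in_gen X [(u, b)]"
proof
  assume "in_gen X [(u, b)]"
  then obtain c where c: "c \<in> words X" "[(u, b)] \<simeq> c" unfolding in_gen_def by blast
  have "act (map fst c) (unit_vec u) u = unit_vec u u"
    using c(1) assms(2) by (intro act_support[of _ X]) (auto simp: words_iff_fst)
  moreover have "act (map fst c) = reflect u" using act_artin[OF c(2)] by (simp add: act_Cons)
  moreover have "reflect u (unit_vec u) u = - unit_vec u u"
    using assms(1) by (simp add: reflect_unit_vec neg_def)
  ultimately show False by (simp add: unit_vec_def)
qed

text \<open>At a missing edge the Chebyshev numbers are taken at \<open>1\<close> and grow linearly,
  so the powers of \<open>u u'\<close> are distinct.\<close>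

lemma not_spherical:
  assumes u: "u \<in> V" "u' \<in> V" "u \<noteq> u'" and nonadj: "label \<Gamma> {u, u'} = None"
  shows "\<not> spherical \<Gamma>"
proof
  assume fin: "spherical \<Gamma>"
  define cls where "cls w = word_rel V coxeter_relations `` {w}" for w
  let ?f = "\<lambda>n. cls (alt_word (2 * n) u u')"
  have alt_V: "alt_word k u u' \<in> words V" for k using u by (intro alt_word_words)
  have "inj ?f"
  proof (rule injI)
    fix n k assume "?f n = ?f k"
    then have "word_equiv V coxeter_relations (alt_word (2 * n) u u') (alt_word (2 * k) u u')"
      using word_class_eq_iff[OF alt_V alt_V] by (simp add: cls_def)
    then have "act (alt (2 * n) u u') = act (alt (2 * k) u u')" by (rule act_coxeter)
    then have "beta (2 * n) u u' = beta (2 * k) u u'"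
      using act_alt_unit_vec[OF u, of "2 * n"] act_alt_unit_vec[OF u, of "2 * k"] by simp
    then have "beta (2 * n) u u' u = beta (2 * k) u u' u" by simp
    moreover have "bil u u' = -1" using u(3) nonadj by (simp add: bil_def)
    ultimately show "n = k" using u(3) by (simp add: beta_def lincomb_def cheb_one unit_vec_def)
  qed
  then have "infinite (range ?f)" by (rule range_inj_infinite)
  moreover have "range ?f \<subseteq> carrier (coxeter_group \<Gamma>)"
    using alt_V by (auto simp: coxeter_group_def carrier_presented_group cls_def)
  ultimately show False using fin finite_subset unfolding spherical_def by blast
qed

lemma spherical_singleton:
  assumes "V = {t}"
  shows "spherical \<Gamma>"
proof -
  let ?R = coxeter_relations
  note trans = word_equiv.trans[of V ?R]
  have t: "t \<in> V" using assms by simp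
  have sq: "word_equiv V ?R [(t, True), (t, True)] []"
    using word_equiv.relation[of "[]" V "[]" "[(t, True), (t, True)]" "[]" ?R] t by simp
  have canc: "word_equiv V ?R [(t, False), (t, True)] []"
    using word_equiv.cancel[of "[]" V "[]" t ?R False] t by simp
  have refl1: "word_equiv V ?R [(t, b)] [(t, b)]" for b using t by (intro word_equiv.refl) simp
  have "word_equiv V ?R ([(t, False), (t, True)] @ [(t, True)]) ([] @ [(t, True)])"
    by (intro word_equiv_append2 canc refl1)
  moreover have "word_equiv V ?R ([(t, False)] @ [(t, True), (t, True)]) ([(t, False)] @ [])"
    by (intro word_equiv_append2 sq refl1)
  ultimately have inv: "word_equiv V ?R [(t, False)] [(t, True)]"
    by simp (blast intro: word_equiv.sym word_equiv.trans)
  have "word_equiv V ?R w [] \<or> word_equiv V ?R w [(t, True)]" if "w \<in> words V" for w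
    using that
  proof (induction w)
    case Nil
    then show ?case by (simp add: word_equiv.refl)
  next
    case (Cons a w)
    obtain b where a: "a = (t, b)" using Cons.prems assms by (cases a) auto
    have "word_equiv V ?R [a] [(t, True)]" using inv refl1 a by (cases b) auto
    note app = word_equiv_append2[OF this]
    consider "word_equiv V ?R w []" | "word_equiv V ?R w [(t, True)]" using Cons by auto
    then show ?case
    proof cases
      case 1
      then show ?thesis using app[OF 1] by simp
    next
      case 2
      then have "word_equiv V ?R (a # w) [(t, True), (t, True)]" using app[OF 2] by simp
      then show ?thesis using sq trans by blast
    qed
  qed
  then have "word_rel V ?R `` {w} \<in> {word_rel V ?R `` {[]}, word_rel V ?R `` {[(t, True)]}}"
    if "w \<in> words V" for w
    using that t by (simp add: word_class_eq_iff)
  then have "carrier (coxeter_group \<Gamma>) \<subseteq> {word_rel V ?R `` {[]}, word_rel V ?R `` {[(t, True)]}}"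
    unfolding coxeter_group_def carrier_presented_group by blast
  then show ?thesis unfolding spherical_def using finite_subset by blast
qed

section \<open>Powers of a generator\<close>

definition exponent_sum :: "'a word \<Rightarrow> int" where
  "exponent_sum w = (\<Sum>a\<leftarrow>w. if snd a then 1 else -1)"

lemma exponent_sum_simps [simp]:
  "exponent_sum [] = 0"
  "exponent_sum (a # w) = (if snd a then 1 else -1) + exponent_sum w"
  "exponent_sum (u @ v) = exponent_sum u + exponent_sum v"
  by (simp_all add: exponent_sum_def)

text \<open>Both sides of a braid relation have equally many letters, all positive. This separates
  the powers of \<open>t\<close>.\<close>

lemma exponent_sum_eq:
  assumes "w \<simeq> w'"
  shows "exponent_sum w = exponent_sum w'"
proof -
  define st :: "'a \<times> bool \<Rightarrow> int \<Rightarrow> int" where "st a n = n + (if snd a then 1 else -1)" for a n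
  have fold_st: "fold st w n = n + exponent_sum w" for w n
    by (induction w arbitrary: n) (auto simp: st_def)
  have alt: "exponent_sum (alt_word k s t) = int k" for k and s t :: 'a
    by (induction k arbitrary: s t) auto
  have "fold st w 0 = fold st w' 0"
    by (rule fold_word_equiv[where Rel = "(=)", OF _ _ _ _ _ assms])
      (auto simp: artin_relations_def fold_st alt, auto simp: st_def)
  then show ?thesis by (simp add: fold_st)
qed

definition power_word :: "'a \<Rightarrow> int \<Rightarrow> 'a word" where
  "power_word t n = replicate (nat \<bar>n\<bar>) (t, 0 \<le> n)"

lemma power_word_0 [simp]: "power_word t 0 = []"
  by (simp add: power_word_def)

lemma power_word_words: "t \<in> X \<Longrightarrow> power_word t n \<in> words X"
  by (auto simp: power_word_def words_iff_fst)

lemma exponent_sum_power_word [simp]: "exponent_sum (power_word t n) = n"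
proof -
  have "exponent_sum (replicate k (t, b)) = (if b then int k else - int k)" for k and b
    by (induction k) auto
  then show ?thesis by (simp add: power_word_def)
qed

lemma power_word_step:
  assumes "t \<in> V"
  shows "(t, b) # power_word t n \<simeq> power_word t ((if b then 1 else -1) + n)"
proof -
  let ?e = "(if b then 1 else -1) :: int"
  note words = power_word_words[OF assms]
  show ?thesis
  \<comment> \<open>Either the new letter extends the power or it cancels against its first
    letter.\<close>
  proof (cases "n = 0 \<or> (b \<longleftrightarrow> 0 < n)")
    case True
    have "power_word t (?e + n) = (t, b) # power_word t n"
    proof -
      have "nat \<bar>?e + n\<bar> = Suc (nat \<bar>n\<bar>)" "(0 \<le> ?e + n) = b" "n = 0 \<or> (0 \<le> n) = b"
        using True by auto
      then show ?thesis by (auto simp: power_word_def)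
    qed
    then show ?thesis using words[of "?e + n"] eq_refl by simp
  next
    case False
    have "power_word t n = (t, \<not> b) # power_word t (?e + n)"
    proof -
      have "nat \<bar>n\<bar> = Suc (nat \<bar>?e + n\<bar>)" "(0 \<le> n) = (\<not> b)" "?e + n = 0 \<or> (0 \<le> ?e + n) = (\<not> b)"
        using False by auto
      then show ?thesis by (auto simp: power_word_def)
    qed
    moreover have "[] @ [(t, b), (t, \<not> b)] @ power_word t (?e + n) \<simeq> [] @ power_word t (?e + n)"
      using words assms by (intro word_equiv.cancel) auto
    ultimately show ?thesis by simp
  qed
qed

lemma eq_power_word:
  assumes "t \<in> V" "w \<in> words {t}"
  shows "w \<simeq> power_word t (exponent_sum w)"
  using assms(2)
proof (induction w)
  case Nil
  then show ?case by (simp add: eq_refl)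
next
  case (Cons a w)
  then obtain b where a: "a = (t, b)" by (cases a) auto
  have "[a] @ w \<simeq> [a] @ power_word t (exponent_sum w)"
    using Cons a assms(1) by (intro eq_append eq_refl) auto
  also have "[a] @ power_word t (exponent_sum w) \<simeq> power_word t (exponent_sum (a # w))"
    using power_word_step[OF assms(1), of b] by (simp add: a)
  finally show ?case by simp
qed

section \<open>The center\<close>

lemma commute_inv_word:
  assumes "u @ v \<simeq> v @ u"
  shows "inv_word u @ v \<simeq> v @ inv_word u"
proof -
  have "v \<simeq> inv_word u @ v @ u" using assms by (rule eq_cancel_left)
  then have "(inv_word u @ v) @ u \<simeq> v" using eq_sym by simp
  then show ?thesis by (rule eq_cancel_right)
qed

lemma commute_letters:
  assumes "[(x, True)] @ [(y, True)] \<simeq> [(y, True)] @ [(x, True)]"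
  shows "[(x, b)] @ [(y, c)] \<simeq> [(y, c)] @ [(x, b)]"
proof -
  have inv: "inv_word [(z, True)] = [(z, False)]" for z :: 'a by (simp add: inv_word_def)
  have 1: "[(x, b)] @ [(y, True)] \<simeq> [(y, True)] @ [(x, b)]"
    using assms commute_inv_word[OF assms] by (cases b) (simp_all add: inv)
  show ?thesis
    using 1 commute_inv_word[OF eq_sym[OF 1]] by (cases c) (simp_all add: inv eq_sym)
qed

lemma commute_words:
  assumes "z \<in> words V" "w \<in> words V"
    and "\<And>a b. a \<in> set z \<Longrightarrow> b \<in> set w \<Longrightarrow> [a] @ [b] \<simeq> [b] @ [a]"
  shows "z @ w \<simeq> w @ z"
proof -
  have 1: "[a] @ w \<simeq> w @ [a]" if "fst a \<in> V" "w \<in> words V" "\<And>b. b \<in> set w \<Longrightarrow> [a] @ [b] \<simeq> [b] @ [a]"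
    for a w
    using that(2,3)
  proof (induction w)
    case Nil
    then show ?case using that(1) by (simp add: eq_refl)
  next
    case (Cons b w)
    have "([a] @ [b]) @ w \<simeq> ([b] @ [a]) @ w"
      by (rule eq_append[OF Cons.prems(2) eq_refl]) (use Cons.prems in auto)
    moreover have "[b] @ [a] @ w \<simeq> [b] @ w @ [a]"
      by (rule eq_append[OF eq_refl Cons.IH]) (use Cons.prems in auto)
    ultimately show ?case by simp (rule eq_trans)
  qed
  show ?thesis using assms(1,3)
  proof (induction z)
    case Nil
    then show ?case using assms(2) by (simp add: eq_refl)
  next
    case (Cons a z)
    have "[a] @ z @ w \<simeq> [a] @ w @ z"
      by (rule eq_append[OF eq_refl Cons.IH]) (use Cons.prems in auto)
    moreover have "([a] @ w) @ z \<simeq> (w @ [a]) @ z"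
      by (rule eq_append[OF 1 eq_refl]) (use Cons.prems assms(2) in auto)
    ultimately show ?case by simp (rule eq_trans)
  qed
qed

definition word_class :: "'a word \<Rightarrow> 'a word set" where
  "word_class w = word_rel V (artin_relations \<Gamma>) `` {w}"

lemma artin_group_simps:
  "carrier (artin_group \<Gamma>) = word_class ` words V"
  "\<one>\<^bsub>artin_group \<Gamma>\<^esub> = word_class []"
  "u \<in> words V \<Longrightarrow> v \<in> words V \<Longrightarrow> word_class u \<otimes>\<^bsub>artin_group \<Gamma>\<^esub> word_class v = word_class (u @ v)"
  "u \<in> words V \<Longrightarrow> v \<in> words V \<Longrightarrow> word_class u = word_class v \<longleftrightarrow> u \<simeq> v"
  unfolding word_class_def
  by (simp_all add: artin_group_def carrier_presented_group presented_group_mult word_class_eq_iff)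
    (simp add: presented_group_def)

lemma center_artin_group:
  "center (artin_group \<Gamma>) = word_class ` {z \<in> words V. \<forall>w\<in>words V. z @ w \<simeq> w @ z}"
proof -
  have "word_class z \<otimes>\<^bsub>artin_group \<Gamma>\<^esub> word_class w = word_class w \<otimes>\<^bsub>artin_group \<Gamma>\<^esub> word_class z
      \<longleftrightarrow> z @ w \<simeq> w @ z" if "z \<in> words V" "w \<in> words V" for z w
    using that by (simp add: artin_group_simps(3,4))
  then show ?thesis unfolding center_def artin_group_simps(1) by blast
qed

context
  fixes t
  assumes t: "t \<in> V" and nonadj: "\<And>u. u \<in> V \<Longrightarrow> u \<noteq> t \<Longrightarrow> \<exists>u'\<in>V. u' \<noteq> u \<and> label \<Gamma> {u, u'} = None"
begin

lemma central_power:
  assumes z: "z \<in> words V" "\<And>w. w \<in> words V \<Longrightarrow> z @ w \<simeq> w @ z"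
  shows "\<exists>n. z \<simeq> power_word t n"
proof -
  have one: "in_gen (V - {u}) z" if u: "u \<in> V" "u \<noteq> t" for u
  proof -
    obtain u' where u': "u' \<in> V" "u \<noteq> u'" "label \<Gamma> {u, u'} = None" using nonadj[OF u] by blast
    have "in_gen (V - {u, u'}) z"
    proof (rule central_in_gen[OF u(1) u' z(1)])
      show "[(v, True)] @ z \<simeq> z @ [(v, True)]" if "v \<in> V" for v
        by (rule eq_sym[OF z(2)]) (use that in simp)
    qed (use u u' in \<open>simp_all add: vertex_not_in_gen\<close>)
    then show ?thesis unfolding in_gen_def using words_mono[of "V - {u, u'}" "V - {u}"] by blast
  qed
  \<comment> \<open>The vertices other than \<open>t\<close> are removed one at a time by
    \<open>in_gen_Int\<close>.\<close>
  have "in_gen (V - U) z" if "finite U" "U \<subseteq> V - {t}" for U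
    using that
  proof (induction rule: finite_subset_induct)
    case empty
    then show ?case using z(1) by (intro in_gen_base) auto
  next
    case (insert u U)
    have "in_gen ((V - U) \<inter> (V - {u})) z"
      using insert one by (intro in_gen_Int) auto
    moreover have "(V - U) \<inter> (V - {u}) = V - insert u U" by blast
    ultimately show ?case by simp
  qed
  from this[of "V - {t}"] have "in_gen {t} z" using t by (simp add: double_diff)
  then obtain c where "c \<in> words {t}" "z \<simeq> c" unfolding in_gen_def by blast
  then show ?thesis using eq_power_word[OF t] eq_trans by blast
qed

lemma center_trivial:
  assumes "label \<Gamma> {s, t} = Some m" "m \<noteq> 2"
  shows "center (artin_group \<Gamma>) = {\<one>\<^bsub>artin_group \<Gamma>\<^esub>}"
proof -
  have "z \<simeq> []" if z: "z \<in> words V" "\<And>w. w \<in> words V \<Longrightarrow> z @ w \<simeq> w @ z" for z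
  proof -
    obtain n where n: "z \<simeq> power_word t n" using central_power z by blast
    have s: "[(s, True)] \<in> words V" using labelD[OF assms(1)] by simp
    have "[(s, True)] @ power_word t n \<simeq> [(s, True)] @ z" "z @ [(s, True)] \<simeq> power_word t n @ [(s, True)]"
      by (rule eq_append[OF eq_refl[OF s] eq_sym[OF n]], rule eq_append[OF n eq_refl[OF s]])
    then have "[(s, True)] @ power_word t n \<simeq> power_word t n @ [(s, True)]"
      using z(2)[OF s] by (meson eq_sym eq_trans)
    then have "power_word t n \<simeq> []"
      using commuting_power_trivial[OF assms power_word_words] by blast
    then show ?thesis using n eq_trans by blast
  qed
  then have "word_class z = word_class []" if "z \<in> words V" "\<forall>w\<in>words V. z @ w \<simeq> w @ z" for z
    using that by (simp add: artin_group_simps(4))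
  moreover have "[] \<in> {z \<in> words V. \<forall>w\<in>words V. z @ w \<simeq> w @ z}" using eq_refl by simp
  ultimately show ?thesis
    unfolding center_artin_group artin_group_simps(2) by blast
qed

lemma center_powers:
  assumes "\<And>s. s \<in> V \<Longrightarrow> s \<noteq> t \<Longrightarrow> label \<Gamma> {s, t} = Some 2"
  shows "center (artin_group \<Gamma>) = range (\<lambda>n. word_class (power_word t n))"
proof -
  note pow_V = power_word_words[OF t]
  have comm: "[(s, b)] @ [(t, c)] \<simeq> [(t, c)] @ [(s, b)]" if "s \<in> V" for s b c
  proof (rule commute_letters)
    show "[(s, True)] @ [(t, True)] \<simeq> [(t, True)] @ [(s, True)]"
    proof (cases "s = t")
      case True
      then show ?thesis using t eq_refl by simp
    next
      case False
      then show ?thesis using braid_eq[OF assms[OF that]] by (simp add: numeral_2_eq_2)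
    qed
  qed
  have "power_word t n @ w \<simeq> w @ power_word t n" if "w \<in> words V" for n w
  proof (rule commute_words[OF pow_V that])
    fix a b assume ab: "a \<in> set (power_word t n)" "b \<in> set w"
    have "fst a = t" using ab(1) by (auto simp: power_word_def)
    moreover have "fst b \<in> V" using ab(2) that unfolding words_iff_fst by auto
    ultimately show "[a] @ [b] \<simeq> [b] @ [a]"
      using eq_sym[OF comm[of "fst b" "snd b" "snd a"]] by (cases a; cases b) simp
  qed
  then have "range (\<lambda>n. word_class (power_word t n)) \<subseteq> center (artin_group \<Gamma>)"
    unfolding center_artin_group using pow_V by blast
  moreover have "center (artin_group \<Gamma>) \<subseteq> range (\<lambda>n. word_class (power_word t n))"
  proof
    fix x assume "x \<in> center (artin_group \<Gamma>)"
    then obtain z where z: "x = word_class z" "z \<in> words V" "\<forall>w\<in>words V. z @ w \<simeq> w @ z"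
      unfolding center_artin_group by blast
    then obtain n where "z \<simeq> power_word t n" using central_power by blast
    then have "x = word_class (power_word t n)" using z artin_group_simps(4)[OF z(2) pow_V] by simp
    then show "x \<in> range (\<lambda>n. word_class (power_word t n))" by blast
  qed
  ultimately show ?thesis by (rule subset_antisym[rotated])
qed

lemma card_spherical_factors:
  "card {D \<in> irreducible_factors \<Gamma>. spherical D}
    = (if \<forall>s\<in>V - {t}. label \<Gamma> {s, t} = Some 2 then 1 else 0)"
proof -
  obtain Ds where Ds: "irreducible_decomposition \<Gamma> Ds"
    using irreducible_decomposition_exists[OF defining] by blast
  have factors: "irreducible_factors \<Gamma> = set Ds" using irreducible_factors_eq[OF Ds] .
  note dec = Ds[unfolded irreducible_decomposition_iff]
  have D_eq: "D = induced \<Gamma> (verts D)" and D_irr: "irreducible_graph D" and D_sub: "verts D \<subseteq> V"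
    and D_two: "\<And>a b. a \<in> verts D \<Longrightarrow> b \<in> V - verts D \<Longrightarrow> label \<Gamma> {a, b} = Some 2"
    if "D \<in> set Ds" for D
    using dec that by blast+
  have lab: "label D {a, b} = label \<Gamma> {a, b}" if "D \<in> set Ds" "a \<in> verts D" "b \<in> verts D" for D a b
    using arg_cong[OF D_eq[OF that(1)], of "\<lambda>D. label D {a, b}"] that(2,3) by (simp add: induced_def)
  have artin_D: "artin D" if "D \<in> set Ds" for D
    using D_irr[OF that] by (simp add: artin_def irreducible_graph_def)
  have sph: "verts D = {t}" if D: "D \<in> set Ds" "spherical D" for D
  proof -
    have "u = t" if u: "u \<in> verts D" for u
    proof (rule ccontr)
      assume "u \<noteq> t"
      moreover have uV: "u \<in> V" using u D_sub[OF D(1)] by blast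
      ultimately obtain u' where u': "u' \<in> V" "u' \<noteq> u" "label \<Gamma> {u, u'} = None" using nonadj by blast
      \<comment> \<open>Vertices of different factors are joined by an edge labelled
        \<open>2\<close>, so a non-neighbour of \<open>u\<close> lies in the factor of
        \<open>u\<close>.\<close>
      then have "u' \<in> verts D" using D_two[OF D(1) u, of u'] by auto
      then have "\<not> spherical D"
        using artin.not_spherical[OF artin_D[OF D(1)] u] u' lab[OF D(1) u] by auto
      then show False using D(2) by simp
    qed
    moreover have "verts D \<noteq> {}" using D_irr[OF D(1)] by (simp add: irreducible_graph_def)
    ultimately show ?thesis by blast
  qed
  show ?thesis
  proof (cases "\<forall>s\<in>V - {t}. label \<Gamma> {s, t} = Some 2")
    case True
    obtain D where D: "D \<in> set Ds" "t \<in> verts D" using dec t by blast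
    have defD: "defining_graph D" using D_irr[OF D(1)] by (simp add: irreducible_graph_def)
    \<comment> \<open>Otherwise \<open>t\<close> would split off from \<open>D\<close> as a join
      factor.\<close>
    have D_t: "verts D = {t}"
    proof (rule ccontr)
      assume ne: "verts D \<noteq> {t}"
      let ?A = "induced D {t}" and ?B = "induced D (verts D - {t})"
      have "label D {a, b} = Some 2" if "a \<in> {t}" "b \<in> verts D - {t}" for a b
        using that True lab[OF D] D_sub[OF D(1)] by (auto simp: insert_commute)
      then have "D = join2 ?A ?B" using defD D(2) by (intro join2_split) auto
      moreover have "defining_graph ?A" "defining_graph ?B"
        using defD D(2) by (auto intro: defining_graph_induced)
      moreover have "verts ?A \<noteq> {}" "verts ?B \<noteq> {}" "verts ?A \<inter> verts ?B = {}"
        using ne D(2) by auto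
      ultimately show False using D_irr[OF D(1)] unfolding irreducible_graph_def by blast
    qed
    have "{D \<in> irreducible_factors \<Gamma>. spherical D} = {D}"
    proof (intro equalityI subsetI)
      fix D' assume "D' \<in> {D \<in> irreducible_factors \<Gamma>. spherical D}"
      then have D': "D' \<in> set Ds" "verts D' = {t}" using sph factors by auto
      then show "D' \<in> {D}" using D_eq[OF D'(1)] D_eq[OF D(1)] D_t by simp
    next
      fix D' assume "D' \<in> {D}"
      then show "D' \<in> {D \<in> irreducible_factors \<Gamma>. spherical D}"
        using D(1) factors artin.spherical_singleton[OF artin_D[OF D(1)] D_t] by simp
    qed
    then show ?thesis using True by simp
  next
    case False
    have empty: "{D \<in> irreducible_factors \<Gamma>. spherical D} = {}"
    proof (rule ccontr)
      assume "\<not> ?thesis"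
      then obtain D where D: "D \<in> set Ds" "verts D = {t}" using sph factors by blast
      have "label \<Gamma> {s, t} = Some 2" if "s \<in> V - {t}" for s
        using D_two[OF D(1), of t s] that D(2) by (simp add: insert_commute)
      then show False using False by blast
    qed
    show ?thesis unfolding empty using False by auto
  qed
qed

end

end

section \<open>Isomorphism type of the center, and the theorem\<close>

lemma trivial_iso_product_group:
  "G\<lparr>carrier := {\<one>\<^bsub>G\<^esub>}\<rparr> \<cong> product_group {..<0::nat} (\<lambda>_. integer_group)"
  if "group G" for G :: "('b, 'c) monoid_scheme"
proof -
  interpret group G by (rule that)
  \<comment> \<open>Over the empty index set the only extensional function is the one with constant
    value \<open>undefined\<close>.\<close>
  have "(\<lambda>_ _. undefined) \<in> iso (G\<lparr>carrier := {\<one>\<^bsub>G\<^esub>}\<rparr>) (product_group {..<0::nat} (\<lambda>_. integer_group))"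
    by (auto simp: iso_def hom_def bij_betw_def)
  then show ?thesis unfolding is_iso_def by blast
qed

lemma (in artin) powers_iso_product_group:
  assumes t: "t \<in> V"
  shows "(artin_group \<Gamma>)\<lparr>carrier := range (\<lambda>n. word_class (power_word t n))\<rparr>
    \<cong> product_group {..<1::nat} (\<lambda>_. integer_group)"
proof -
  let ?P = "product_group {..<1::nat} (\<lambda>_. integer_group)"
  let ?Z = "(artin_group \<Gamma>)\<lparr>carrier := range (\<lambda>n. word_class (power_word t n))\<rparr>"
  let ?f = "\<lambda>x. word_class (power_word t (x 0))"
  note pow_V = power_word_words[OF t]
  have inj: "m = n" if "word_class (power_word t m) = word_class (power_word t n)" for m n
    using that exponent_sum_eq[of "power_word t m" "power_word t n"]
    by (simp add: artin_group_simps(4)[OF pow_V pow_V])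
  have "power_word t m @ power_word t n \<simeq> power_word t (m + n)" for m n
    using eq_power_word[OF t, of "power_word t m @ power_word t n"] power_word_words by simp
  then have add: "word_class (power_word t m @ power_word t n) = word_class (power_word t (m + n))" for m n
    by (simp add: artin_group_simps(4) pow_V)
  have "?f \<in> iso ?P ?Z"
    unfolding iso_def
  proof (intro CollectI conjI)
    show "?f \<in> hom ?P ?Z"
      by (auto simp: hom_def artin_group_simps(3)[OF pow_V pow_V] add)
    show "bij_betw ?f (carrier ?P) (carrier ?Z)"
    proof (rule bij_betwI')
      fix x y assume xy: "x \<in> carrier ?P" "y \<in> carrier ?P"
      have "x = y" if "?f x = ?f y"
      proof (rule PiE_ext[OF xy[unfolded carrier_product_group]])
        show "x i = y i" if "i \<in> {..<1}" for i using that inj[OF \<open>?f x = ?f y\<close>] by simp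
      qed
      then show "?f x = ?f y \<longleftrightarrow> x = y" by blast
    next
      fix x assume "x \<in> carrier ?Z"
      then obtain n where "x = word_class (power_word t n)" by auto
      then show "\<exists>y\<in>carrier ?P. x = ?f y"
        by (intro bexI[of _ "\<lambda>i\<in>{..<1}. n"]) simp_all
    next
      show "?f x \<in> carrier ?Z" for x by simp
    qed
  qed
  then have "?P \<cong> ?Z" unfolding is_iso_def by blast
  then show ?thesis by (rule group.iso_sym[OF product_group[OF group_integer_group]])
qed

theorem corollary2p3:
  fixes \<Gamma> :: "'a lgraph" and t :: 'a
  assumes "defining_graph \<Gamma>"
    and "cone_point \<Gamma> t"
    and "\<And>u. cone_point \<Gamma> u \<Longrightarrow> u = t"
  shows "satisfies_center_conjecture \<Gamma> \<and>
    (center (artin_group \<Gamma>) = {\<one>\<^bsub>artin_group \<Gamma>\<^esub>} \<longleftrightarrow>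
      (\<exists>s\<in>verts \<Gamma> - {t}. m_label \<Gamma> s t \<noteq> 2))"
proof -
  interpret artin \<Gamma> by standard (rule assms(1))
  have t: "t \<in> V" and adj: "\<And>s. s \<in> V \<Longrightarrow> s \<noteq> t \<Longrightarrow> \<exists>m. label \<Gamma> {s, t} = Some m"
    using assms(2) by (auto simp: cone_point_def adjacent_def)
  \<comment> \<open>Uniqueness of the cone point enters here: no vertex \<open>u\<close> other than
    \<open>t\<close> is a cone point.\<close>
  have nonadj: "\<exists>u'\<in>V. u' \<noteq> u \<and> label \<Gamma> {u, u'} = None" if u: "u \<in> V" "u \<noteq> t" for u
  proof -
    obtain u' where "u' \<in> V - {u}" "\<not> adjacent \<Gamma> u' u"
      using assms(3)[of u] u unfolding cone_point_def by blast
    then show ?thesis by (auto simp: adjacent_def domIff insert_commute)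
  qed
  have two: "m_label \<Gamma> s t = 2 \<longleftrightarrow> label \<Gamma> {s, t} = Some 2" for s
    by (auto simp: m_label_def numeral_eq_enat split: option.splits)
  have card: "card {D \<in> irreducible_factors \<Gamma>. spherical D}
      = (if \<forall>s\<in>V - {t}. label \<Gamma> {s, t} = Some 2 then 1 else 0)"
    by (rule card_spherical_factors[OF t nonadj])
  show ?thesis
  proof (cases "\<forall>s\<in>V - {t}. label \<Gamma> {s, t} = Some 2")
    case True
    have Z: "center (artin_group \<Gamma>) = range (\<lambda>n. word_class (power_word t n))"
      using True by (intro center_powers[OF t nonadj]) auto
    \<comment> \<open>The exponent sum shows that \<open>t\<close> is not trivial, so the center,
      here generated by \<open>t\<close>, is not either.\<close>
    have "\<not> power_word t 1 \<simeq> []" using exponent_sum_eq[of "power_word t 1" "[]"] by auto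
    moreover have "power_word t 1 \<in> words V" using t by (simp add: power_word_def)
    ultimately have "word_class (power_word t 1) \<noteq> \<one>\<^bsub>artin_group \<Gamma>\<^esub>"
      by (simp add: artin_group_simps)
    then have "center (artin_group \<Gamma>) \<noteq> {\<one>\<^bsub>artin_group \<Gamma>\<^esub>}" unfolding Z by blast
    moreover have "satisfies_center_conjecture \<Gamma>"
      using powers_iso_product_group[OF t] True
      unfolding satisfies_center_conjecture_def card Z by simp
    ultimately show ?thesis using True two by blast
  next
    case False
    then obtain s m where s: "s \<in> V - {t}" "label \<Gamma> {s, t} = Some m" "m \<noteq> 2" using adj by force
    have Z: "center (artin_group \<Gamma>) = {\<one>\<^bsub>artin_group \<Gamma>\<^esub>}"
      using center_trivial[OF t nonadj s(2,3)] .
    moreover have "satisfies_center_conjecture \<Gamma>"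
      using trivial_iso_product_group[OF group_presented_group[of V "artin_relations \<Gamma>"]] False
      unfolding satisfies_center_conjecture_def card Z artin_group_def[symmetric] by auto
    ultimately show ?thesis using False two by blast
  qed
qed

end
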